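(* Let $(b_n)_{n\ge1}\in\ell^2$ with $b_1\neq0$, $\|(b_n)\|_2<1$ and such that $\sum_{n\ge1}|b_n|^2z^n$ has radius of convergence $1$. Let $f(z)=(b_1z,b_2z^2,b_3z^3,\dots)$ for $z\in\overline{\mathbb{D}}$ and $\overline V=f(\overline{\mathbb{D}})$. Define $(a_n)_{n\ge0}$ by $\sum_{n\ge0}a_nz^n=\big(1-\sum_{n\ge1}|b_n|^2z^n\big)^{-1}$, and suppose that $\sup_{n\ge1}\sum_{k=0}^n\frac{a_ka_{n-k}}{a_n}<\infty$ and that $\mathcal{M}_{\overline V}$ is automorphism invariant. Let $(\tilde b_n)_{n\ge1}\in\ell^2$ with $\|(\tilde b_n)\|_2=1$ and $\tilde b_1\neq0$, let $\tilde f(z)=(\tilde b_1z,\tilde b_2z^2,\tilde b_3z^3,\dots)$ for $z\in\mathbb{D}$, and let $\tilde V=\tilde f(\mathbb{D})$. Then there is no unital surjective algebra homomorphism from $\mathcal{M}_{\overline V}$ onto $\mathcal{M}_{\tilde V}$. In particular, $\mathcal{M}_{\overline V}$ and $\mathcal{M}_{\tilde V}$ are not isomorphic.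
   Context: $\mathbb{B}_\infty$ is the open unit ball of $\ell^2$. The Drury-Arveson space $\mathcal{H}_\infty$ is the reproducing kernel Hilbert space on $\mathbb{B}_\infty$ with kernel $k(x,y)=\frac{1}{1-\langle x,y\rangle}$, $k_y(x)=k(x,y)$. For $X\subset\mathbb{B}_\infty$ a variety (an intersection of zero sets in $\mathbb{B}_\infty$ of multipliers of $\mathcal{H}_\infty$), $\mathcal{H}_X=\overline{\operatorname{span}}\{k_y:y\in X\}$, considered as a Hilbert space of functions on $X$, and $\mathcal{M}_X$ is its multiplier algebra (functions on $X$). Both $\overline V$ and $\tilde V$ above are varieties in $\mathbb{B}_\infty$. $\mathcal{M}_{\overline V}$ is automorphism invariant if for every conformal automorphism $\theta$ of $\mathbb{D}$ (extended to $\overline{\mathbb{D}}$), composition with $f\circ\theta\circ f^{-1}$ is an automorphism of $\mathcal{M}_{\overline V}$. *)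

theory Defs
  imports "HOL-Analysis.Analysis" "HOL-Complex_Analysis.Complex_Analysis"
begin

text \<open>
  A function on a set \<open>X\<close> is represented by a total function that vanishes outside \<open>X\<close>.
  Thus pointwise sums, products and scalar multiples of functions on \<open>X\<close> are again functions
  on \<open>X\<close>, and the constant function \<open>1\<close> on \<open>X\<close> is \<^term>\<open>indicator X\<close>.
\<close>

definition restrict_zero :: "'a set \<Rightarrow> ('a \<Rightarrow> complex) \<Rightarrow> 'a \<Rightarrow> complex" where
  "restrict_zero X h = (\<lambda>x. if x \<in> X then h x else 0)"


section \<open>Reproducing kernel Hilbert spaces and multipliers\<close>

definition ip_norm :: "(('a \<Rightarrow> complex) \<Rightarrow> ('a \<Rightarrow> complex) \<Rightarrow> complex) \<Rightarrow> ('a \<Rightarrow> complex) \<Rightarrow> real" where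
  "ip_norm ip h = sqrt (Re (ip h h))"

locale hilbert_function_space =
  fixes X :: "'a set"
    and H :: "('a \<Rightarrow> complex) set"
    and ip :: "('a \<Rightarrow> complex) \<Rightarrow> ('a \<Rightarrow> complex) \<Rightarrow> complex"
  assumes vanish_outside: "h \<in> H \<Longrightarrow> x \<notin> X \<Longrightarrow> h x = 0"
    and zero_mem: "(\<lambda>x. 0) \<in> H"
    and add_mem: "g \<in> H \<Longrightarrow> h \<in> H \<Longrightarrow> (\<lambda>x. g x + h x) \<in> H"
    and scale_mem: "h \<in> H \<Longrightarrow> (\<lambda>x. c * h x) \<in> H"
    and ip_add: "g \<in> H \<Longrightarrow> h \<in> H \<Longrightarrow> u \<in> H \<Longrightarrow> ip (\<lambda>x. g x + h x) u = ip g u + ip h u"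
    and ip_scale: "h \<in> H \<Longrightarrow> u \<in> H \<Longrightarrow> ip (\<lambda>x. c * h x) u = c * ip h u"
    and ip_cnj: "g \<in> H \<Longrightarrow> h \<in> H \<Longrightarrow> ip h g = cnj (ip g h)"
    and ip_nonneg: "h \<in> H \<Longrightarrow> 0 \<le> Re (ip h h)"
    and ip_definite: "h \<in> H \<Longrightarrow> ip h h = 0 \<Longrightarrow> h = (\<lambda>x. 0)"
    and complete: "(\<And>n. s n \<in> H) \<Longrightarrow>
      (\<forall>e>0. \<exists>N. \<forall>m\<ge>N. \<forall>n\<ge>N. ip_norm ip (\<lambda>x. s m x - s n x) < e) \<Longrightarrow>
      \<exists>h\<in>H. (\<lambda>n::nat. ip_norm ip (\<lambda>x. s n x - h x)) \<longlonglongrightarrow> 0"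

definition kernel_fun :: "'a set \<Rightarrow> ('a \<Rightarrow> 'a \<Rightarrow> complex) \<Rightarrow> 'a \<Rightarrow> 'a \<Rightarrow> complex" where
  "kernel_fun X K y = restrict_zero X (\<lambda>x. K x y)"

locale rkhs = hilbert_function_space X H ip
  for X :: "'a set"
    and K :: "'a \<Rightarrow> 'a \<Rightarrow> complex"
    and H :: "('a \<Rightarrow> complex) set"
    and ip :: "('a \<Rightarrow> complex) \<Rightarrow> ('a \<Rightarrow> complex) \<Rightarrow> complex" +
  assumes kernel_mem: "y \<in> X \<Longrightarrow> kernel_fun X K y \<in> H"
    and reproducing: "y \<in> X \<Longrightarrow> h \<in> H \<Longrightarrow> ip h (kernel_fun X K y) = h y"

definition closure_in ::
  "('a \<Rightarrow> complex) set \<Rightarrow> (('a \<Rightarrow> complex) \<Rightarrow> ('a \<Rightarrow> complex) \<Rightarrow> complex) \<Rightarrow>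
   ('a \<Rightarrow> complex) set \<Rightarrow> ('a \<Rightarrow> complex) set" where
  "closure_in H ip S = {h \<in> H. \<forall>e>0. \<exists>g\<in>S. ip_norm ip (\<lambda>x. h x - g x) < e}"

definition kernel_span :: "'a set \<Rightarrow> ('a \<Rightarrow> 'a \<Rightarrow> complex) \<Rightarrow> 'a set \<Rightarrow> ('a \<Rightarrow> complex) set" where
  "kernel_span B K X =
     {(\<lambda>x. \<Sum>y\<in>F. c y * kernel_fun B K y x) | F c. finite F \<and> F \<subseteq> X}"

text \<open>
  For an RKHS \<open>H\<close> on \<open>B\<close> and \<open>X \<subseteq> B\<close>: the closed span in \<open>H\<close> of the kernel functions at
  points of \<open>X\<close>, its elements being regarded as functions on \<open>X\<close>. (Restriction to \<open>X\<close> is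
  injective on this closed span.)
\<close>

definition subspace_on ::
  "'a set \<Rightarrow> ('a \<Rightarrow> 'a \<Rightarrow> complex) \<Rightarrow> ('a \<Rightarrow> complex) set \<Rightarrow>
   (('a \<Rightarrow> complex) \<Rightarrow> ('a \<Rightarrow> complex) \<Rightarrow> complex) \<Rightarrow> 'a set \<Rightarrow> ('a \<Rightarrow> complex) set" where
  "subspace_on B K H ip X = restrict_zero X ` closure_in H ip (kernel_span B K X)"

definition multipliers :: "'a set \<Rightarrow> ('a \<Rightarrow> complex) set \<Rightarrow> ('a \<Rightarrow> complex) set" where
  "multipliers X HX =
     {\<phi>. (\<forall>x. x \<notin> X \<longrightarrow> \<phi> x = 0) \<and> (\<forall>h\<in>HX. (\<lambda>x. \<phi> x * h x) \<in> HX)}"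


section \<open>Algebras of complex functions under pointwise operations\<close>

definition alg_hom ::
  "('a \<Rightarrow> complex) set \<Rightarrow> ('b \<Rightarrow> complex) set \<Rightarrow> (('a \<Rightarrow> complex) \<Rightarrow> 'b \<Rightarrow> complex) \<Rightarrow> bool" where
  "alg_hom A B \<Phi> \<longleftrightarrow>
     (\<forall>\<phi>\<in>A. \<Phi> \<phi> \<in> B) \<and>
     (\<forall>\<phi>\<in>A. \<forall>\<psi>\<in>A. \<Phi> (\<lambda>x. \<phi> x + \<psi> x) = (\<lambda>y. \<Phi> \<phi> y + \<Phi> \<psi> y)) \<and>
     (\<forall>c. \<forall>\<phi>\<in>A. \<Phi> (\<lambda>x. c * \<phi> x) = (\<lambda>y. c * \<Phi> \<phi> y)) \<and>
     (\<forall>\<phi>\<in>A. \<forall>\<psi>\<in>A. \<Phi> (\<lambda>x. \<phi> x * \<psi> x) = (\<lambda>y. \<Phi> \<phi> y * \<Phi> \<psi> y))"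

definition alg_iso ::
  "('a \<Rightarrow> complex) set \<Rightarrow> ('b \<Rightarrow> complex) set \<Rightarrow> (('a \<Rightarrow> complex) \<Rightarrow> 'b \<Rightarrow> complex) \<Rightarrow> bool" where
  "alg_iso A B \<Phi> \<longleftrightarrow> alg_hom A B \<Phi> \<and> bij_betw \<Phi> A B"


section \<open>The Drury--Arveson space and the varieties\<close>

definition l2 :: "(nat \<Rightarrow> complex) set" where
  "l2 = {x. summable (\<lambda>n. (cmod (x n))\<^sup>2)}"

definition l2_norm :: "(nat \<Rightarrow> complex) \<Rightarrow> real" where
  "l2_norm x = sqrt (\<Sum>n. (cmod (x n))\<^sup>2)"

definition l2_inner :: "(nat \<Rightarrow> complex) \<Rightarrow> (nat \<Rightarrow> complex) \<Rightarrow> complex" where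
  "l2_inner x y = (\<Sum>n. x n * cnj (y n))"

definition l2_ball :: "(nat \<Rightarrow> complex) set" where
  "l2_ball = {x \<in> l2. l2_norm x < 1}"

definition da_kernel :: "(nat \<Rightarrow> complex) \<Rightarrow> (nat \<Rightarrow> complex) \<Rightarrow> complex" where
  "da_kernel x y = 1 / (1 - l2_inner x y)"

text \<open>
  By Moore--Aronszajn there is exactly one such space: \<open>H\<close> is uniquely determined, and so is
  \<open>ip\<close> on \<open>H\<close>. The values of \<open>ip\<close> outside \<open>H\<close> are irrelevant.
\<close>

definition drury_arveson ::
  "((nat \<Rightarrow> complex) \<Rightarrow> complex) set \<Rightarrow>
   (((nat \<Rightarrow> complex) \<Rightarrow> complex) \<Rightarrow> ((nat \<Rightarrow> complex) \<Rightarrow> complex) \<Rightarrow> complex) \<Rightarrow> bool" where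
  "drury_arveson H ip \<longleftrightarrow> rkhs l2_ball da_kernel H ip"

text \<open>The multiplier algebra of the space of functions on \<open>X\<close> cut out of the space \<open>(H, ip)\<close>.\<close>

definition mult_alg ::
  "((nat \<Rightarrow> complex) \<Rightarrow> complex) set \<Rightarrow>
   (((nat \<Rightarrow> complex) \<Rightarrow> complex) \<Rightarrow> ((nat \<Rightarrow> complex) \<Rightarrow> complex) \<Rightarrow> complex) \<Rightarrow>
   (nat \<Rightarrow> complex) set \<Rightarrow> ((nat \<Rightarrow> complex) \<Rightarrow> complex) set" where
  "mult_alg H ip X = multipliers X (subspace_on l2_ball da_kernel H ip X)"

text \<open>
  Coefficient sequences \<open>b 1, b 2, \<dots>\<close> start at index \<open>1\<close> and the value \<open>b 0\<close> is never used, while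
  coordinates in \<^const>\<open>l2\<close> start at index \<open>0\<close>; hence the shift in the next two definitions.
\<close>

definition coeff_vec :: "(nat \<Rightarrow> complex) \<Rightarrow> nat \<Rightarrow> complex" where
  "coeff_vec b = (\<lambda>n. b (Suc n))"

definition disc_map :: "(nat \<Rightarrow> complex) \<Rightarrow> complex \<Rightarrow> nat \<Rightarrow> complex" where
  "disc_map b z = (\<lambda>n. b (Suc n) * z ^ Suc n)"

definition sq_fps :: "(nat \<Rightarrow> complex) \<Rightarrow> real fps" where
  "sq_fps b = Abs_fps (\<lambda>n. if n = 0 then 0 else (cmod (b n))\<^sup>2)"

text \<open>
  A conformal automorphism of the open unit disc together with its continuous extension to the
  closed disc.
\<close>

definition disc_automorphism :: "(complex \<Rightarrow> complex) \<Rightarrow> bool" where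
  "disc_automorphism \<theta> \<longleftrightarrow>
     \<theta> holomorphic_on ball 0 1 \<and> bij_betw \<theta> (ball 0 1) (ball 0 1) \<and> continuous_on (cball 0 1) \<theta>"

definition automorphism_invariant ::
  "((nat \<Rightarrow> complex) \<Rightarrow> complex) set \<Rightarrow>
   (((nat \<Rightarrow> complex) \<Rightarrow> complex) \<Rightarrow> ((nat \<Rightarrow> complex) \<Rightarrow> complex) \<Rightarrow> complex) \<Rightarrow>
   (complex \<Rightarrow> nat \<Rightarrow> complex) \<Rightarrow> bool" where
  "automorphism_invariant H ip f \<longleftrightarrow>
     (let V = f ` cball 0 1 in
      \<forall>\<theta>. disc_automorphism \<theta> \<longrightarrow>
        alg_iso (mult_alg H ip V) (mult_alg H ip V)
          (\<lambda>\<phi>. restrict_zero V (\<phi> \<circ> (f \<circ> \<theta> \<circ> inv_into (cball 0 1) f))))"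

end

theory Submission
  imports Defs "HOL-Library.Diagonal_Subsequence"
begin

text \<open>  In the parameter \<open>z\<close> of an embedded disc the kernel of the Drury--Arveson space becomes
  \<open>\<Sum>n. a n * (z * cnj w) ^ n\<close>, where \<open>a\<close> has the generating function \<open>1 / (1 - s)\<close> with
  \<open>s = \<Sum>n. (cmod (b n))\<^sup>2 * z ^ n\<close>. So the space of functions on the disc consists of the power
  series \<open>\<alpha>\<close> with \<open>\<Sum>n. (cmod (\<alpha> n))\<^sup>2 / a n < \<infinity>\<close>; this is \<open>subspace_on_eq\<close>. The two discs are then
  told apart by sequences of characters of their multiplier algebras.

  For the closed disc, the bound on the convolution of \<open>a\<close> with itself makes the weighted space
  closed under products, with a norm that is submultiplicative up to a constant. Hence it is equal
  to its multiplier algebra (\<open>mult_alg_eq\<close>). A unital character is bounded by a constant that does not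
  depend on it (\<open>character_bound\<close>), and polynomials are dense (\<open>polynomials_dense\<close>). So a character
  is controlled by its value at the coordinate function \<open>z\<close>, and any sequence of characters has a
  subsequence that converges at every multiplier (\<open>characters_subconverge\<close>).

  For the open disc with \<open>\<Sum>n. (cmod (bt n))\<^sup>2 = 1\<close>, point evaluations along a sequence \<open>z k\<close> with
  \<open>s (z k) \<rightarrow> 1\<close> have no such subsequence. Multiplication by \<open>s\<close> is a contraction (\<open>contractive_s\<close>).
  Hence so is multiplication by the Blaschke factor \<open>(x - s) / (1 - x * s)\<close> for \<open>0 \<le> x \<le> 1\<close>
  (\<open>contractive_blaschke\<close>), and by finite products and coefficientwise limits of these. After
  thinning out the sequence so that \<open>1 - s (z k)\<close> decays fast, the Blaschke product with
  zeros at every second value of \<open>s\<close> stays away from \<open>0\<close> at the values in between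
  (\<open>contractive_oscillating\<close>), so it is a multiplier that diverges along the sequence
  (\<open>divergent_multiplier\<close>).

  A unital homomorphism \<open>\<Phi>\<close> pulls the evaluations at \<open>z k\<close> back to characters of the first algebra.
  Along a subsequence these converge at every multiplier, so if \<open>\<Phi>\<close> is onto, every multiplier of
  the second disc converges along that subsequence: a contradiction. An algebra isomorphism is
  unital by itself (\<open>alg_iso_unital\<close>), so it is covered as well.\<close>

section \<open>Finite sums\<close>

text \<open>  The Cauchy--Schwarz inequality in the form needed for weights: \<open>x i\<close> is only required to be
  at most the geometric mean of \<open>c i\<close> and \<open>d i\<close>, which may vanish.\<close>

lemma sum_square_le_product:
  fixes x c d :: "'i \<Rightarrow> real"
  assumes "\<And>i. i \<in> A \<Longrightarrow> 0 \<le> c i" "\<And>i. i \<in> A \<Longrightarrow> 0 \<le> d i"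
    and "\<And>i. i \<in> A \<Longrightarrow> (x i)\<^sup>2 \<le> c i * d i"
  shows "(\<Sum>i\<in>A. x i)\<^sup>2 \<le> (\<Sum>i\<in>A. c i) * (\<Sum>i\<in>A. d i)"
proof -
  have "\<bar>\<Sum>i\<in>A. x i\<bar> \<le> (\<Sum>i\<in>A. \<bar>x i\<bar>)" by simp
  also have "\<dots> \<le> (\<Sum>i\<in>A. \<bar>sqrt (c i)\<bar> * \<bar>sqrt (d i)\<bar>)"
  proof (rule sum_mono)
    fix i assume i: "i \<in> A"
    have "\<bar>x i\<bar> = sqrt ((x i)\<^sup>2)" by simp
    also have "\<dots> \<le> sqrt (c i * d i)" using assms(3)[OF i] by (rule real_sqrt_le_mono)
    finally show "\<bar>x i\<bar> \<le> \<bar>sqrt (c i)\<bar> * \<bar>sqrt (d i)\<bar>"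
      using assms(1,2)[OF i] by (simp add: real_sqrt_mult)
  qed
  also have "\<dots> \<le> L2_set (\<lambda>i. sqrt (c i)) A * L2_set (\<lambda>i. sqrt (d i)) A"
    by (rule L2_set_mult_ineq)
  finally have "\<bar>\<Sum>i\<in>A. x i\<bar> \<le> sqrt ((\<Sum>i\<in>A. c i) * (\<Sum>i\<in>A. d i))"
    using assms(1,2) by (simp add: L2_set_def real_sqrt_mult)
  then have "\<bar>\<Sum>i\<in>A. x i\<bar>\<^sup>2 \<le> (sqrt ((\<Sum>i\<in>A. c i) * (\<Sum>i\<in>A. d i)))\<^sup>2"
    by (rule power_mono) simp
  then show ?thesis
    using assms(1,2) by (simp add: sum_nonneg)
qed

text \<open>  The pairs \<open>(k, n - k)\<close> with \<open>k \<le> n \<le> N\<close> form a triangle inside the square \<open>{..N} \<times> {..N}\<close>.\<close>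

lemma sum_convolution_le:
  fixes u v :: "nat \<Rightarrow> real"
  assumes "\<And>n. 0 \<le> u n" "\<And>n. 0 \<le> v n"
  shows "(\<Sum>n\<le>N. \<Sum>k\<le>n. u k * v (n - k)) \<le> (\<Sum>n\<le>N. u n) * (\<Sum>n\<le>N. v n)"
proof -
  have "(\<Sum>n\<le>N. \<Sum>k\<le>n. u k * v (n - k)) = (\<Sum>(i, j)\<in>{(i, j). i + j \<le> N}. u i * v j)"
    by (rule sum.triangle_reindex_eq[symmetric])
  also have "\<dots> \<le> (\<Sum>(i, j)\<in>{..N} \<times> {..N}. u i * v j)"
    using assms by (intro sum_mono2) auto
  also have "\<dots> = (\<Sum>n\<le>N. u n) * (\<Sum>n\<le>N. v n)"
    by (simp add: sum_product sum.cartesian_product)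
  finally show ?thesis .
qed

lemma sum_extend_by_zero:
  assumes "finite F" "finite F'"
  shows "(\<Sum>z\<in>F. c z * k z) = (\<Sum>z\<in>F \<union> F'. (if z \<in> F then c z else 0) * (k z :: complex))"
  using assms by (intro sum.mono_neutral_cong_left) auto

section \<open>Hilbert function spaces\<close>

context hilbert_function_space
begin

lemma uminus_mem: "h \<in> H \<Longrightarrow> (\<lambda>x. - h x) \<in> H"
  using scale_mem[of h "-1"] by simp

lemma diff_mem: "g \<in> H \<Longrightarrow> h \<in> H \<Longrightarrow> (\<lambda>x. g x - h x) \<in> H"
  using add_mem[OF _ uminus_mem] by simp

lemma ip_uminus: "h \<in> H \<Longrightarrow> u \<in> H \<Longrightarrow> ip (\<lambda>x. - h x) u = - ip h u"
  using ip_scale[of h u "-1"] by simp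

lemma ip_diff: "g \<in> H \<Longrightarrow> h \<in> H \<Longrightarrow> u \<in> H \<Longrightarrow> ip (\<lambda>x. g x - h x) u = ip g u - ip h u"
  using ip_add[OF _ uminus_mem] ip_uminus by simp

lemma ip_add_right: "g \<in> H \<Longrightarrow> h \<in> H \<Longrightarrow> u \<in> H \<Longrightarrow> ip u (\<lambda>x. g x + h x) = ip u g + ip u h"
  using ip_cnj[of "\<lambda>x. g x + h x" u] ip_cnj[of g u] ip_cnj[of h u] by (simp add: ip_add add_mem)

lemma ip_diff_right: "g \<in> H \<Longrightarrow> h \<in> H \<Longrightarrow> u \<in> H \<Longrightarrow> ip u (\<lambda>x. g x - h x) = ip u g - ip u h"
  using ip_cnj[of "\<lambda>x. g x - h x" u] ip_cnj[of g u] ip_cnj[of h u] by (simp add: ip_diff diff_mem)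

lemma ip_scale_right: "h \<in> H \<Longrightarrow> u \<in> H \<Longrightarrow> ip u (\<lambda>x. c * h x) = cnj c * ip u h"
  using ip_cnj[of "\<lambda>x. c * h x" u] ip_cnj[of h u] by (simp add: ip_scale scale_mem)

lemma sum_mem: "finite F \<Longrightarrow> (\<And>i. i \<in> F \<Longrightarrow> g i \<in> H) \<Longrightarrow> (\<lambda>x. \<Sum>i\<in>F. c i * g i x) \<in> H"
proof (induction F rule: finite_induct)
  case empty
  then show ?case using zero_mem by simp
next
  case (insert i F)
  then show ?case using add_mem[OF scale_mem[of "g i" "c i"]] by simp
qed

lemma ip_zero: "u \<in> H \<Longrightarrow> ip (\<lambda>x. 0) u = 0"
  using ip_scale[of u u 0] by simp

lemma ip_sum:
  "finite F \<Longrightarrow> (\<And>i. i \<in> F \<Longrightarrow> g i \<in> H) \<Longrightarrow> u \<in> H \<Longrightarrow>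
    ip (\<lambda>x. \<Sum>i\<in>F. c i * g i x) u = (\<Sum>i\<in>F. c i * ip (g i) u)"
proof (induction F rule: finite_induct)
  case empty
  then show ?case using ip_zero by simp
next
  case (insert i F)
  then have "ip (\<lambda>x. c i * g i x + (\<Sum>i\<in>F. c i * g i x)) u
      = ip (\<lambda>x. c i * g i x) u + ip (\<lambda>x. \<Sum>i\<in>F. c i * g i x) u"
    by (intro ip_add scale_mem sum_mem) auto
  then show ?case using insert by (simp add: ip_scale)
qed

lemma ip_self: "h \<in> H \<Longrightarrow> ip h h = of_real ((ip_norm ip h)\<^sup>2)"
  using ip_cnj[of h h] ip_nonneg[of h] unfolding ip_norm_def
  by (simp add: complex_eq_iff)

lemma ip_norm_nonneg: "h \<in> H \<Longrightarrow> 0 \<le> ip_norm ip h"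
  using ip_nonneg unfolding ip_norm_def by simp

lemma Cauchy_Schwarz:
  assumes "g \<in> H" "h \<in> H"
  shows "cmod (ip g h) \<le> ip_norm ip g * ip_norm ip h"
proof (cases "ip h h = 0")
  case True
  then have "h = (\<lambda>x. 0)" using assms ip_definite by blast
  then have "ip g h = 0" using assms ip_cnj[of h g] ip_zero by simp
  then show ?thesis using assms ip_norm_nonneg by simp
next
  case False
  define t where "t = (ip_norm ip h)\<^sup>2"
  have t: "ip h h = of_real t" "t > 0"
    using False ip_self[OF assms(2)] by (auto simp: t_def)
  define c where "c = ip g h / of_real t"
  have m: "(\<lambda>x. c * h x) \<in> H" using assms scale_mem by blast
  have "ip (\<lambda>x. g x - c * h x) (\<lambda>x. g x - c * h x)
      = ip g g - cnj c * ip g h - c * (ip h g - cnj c * ip h h)"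
    using assms m by (simp add: ip_diff ip_diff_right ip_scale ip_scale_right diff_mem algebra_simps)
  also have "\<dots> = ip g g - ip g h * cnj (ip g h) / of_real t"
    using t ip_cnj[OF assms] by (simp add: c_def)
  also have "\<dots> = of_real ((ip_norm ip g)\<^sup>2) - of_real ((cmod (ip g h))\<^sup>2 / t)"
    by (simp only: ip_self[OF assms(1)] complex_norm_square[symmetric] of_real_divide)
  finally have E: "ip (\<lambda>x. g x - c * h x) (\<lambda>x. g x - c * h x)
      = of_real ((ip_norm ip g)\<^sup>2) - of_real ((cmod (ip g h))\<^sup>2 / t)" .
  have "0 \<le> (ip_norm ip g)\<^sup>2 - (cmod (ip g h))\<^sup>2 / t"
    using ip_nonneg[OF diff_mem[OF assms(1) m]] unfolding E by (simp del: of_real_divide of_real_power)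
  then have "(cmod (ip g h))\<^sup>2 / t \<le> (ip_norm ip g)\<^sup>2" by linarith
  then have "(cmod (ip g h))\<^sup>2 \<le> (ip_norm ip g)\<^sup>2 * t"
    using t(2) by (simp only: pos_divide_le_eq)
  then have "(cmod (ip g h))\<^sup>2 \<le> (ip_norm ip g * ip_norm ip h)\<^sup>2"
    by (simp only: t_def power_mult_distrib)
  then show ?thesis
    by (rule power2_le_imp_le) (simp add: assms ip_norm_nonneg)
qed

lemma ip_norm_add_le:
  assumes "g \<in> H" "h \<in> H"
  shows "ip_norm ip (\<lambda>x. g x + h x) \<le> ip_norm ip g + ip_norm ip h"
proof (rule power2_le_imp_le)
  have "ip (\<lambda>x. g x + h x) (\<lambda>x. g x + h x) = ip g g + ip h h + (ip g h + cnj (ip g h))"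
    using assms ip_cnj[of g h] by (simp add: ip_add ip_add_right add_mem algebra_simps)
  then have "(ip_norm ip (\<lambda>x. g x + h x))\<^sup>2
      = (ip_norm ip g)\<^sup>2 + (ip_norm ip h)\<^sup>2 + 2 * Re (ip g h)"
    using assms ip_self[OF add_mem[OF assms]] ip_self[of g] ip_self[of h]
    by (simp add: complex_eq_iff)
  also have "\<dots> \<le> (ip_norm ip g + ip_norm ip h)\<^sup>2"
    using Cauchy_Schwarz[OF assms] complex_Re_le_cmod[of "ip g h"]
    by (simp add: power2_eq_square algebra_simps)
  finally show "(ip_norm ip (\<lambda>x. g x + h x))\<^sup>2 \<le> (ip_norm ip g + ip_norm ip h)\<^sup>2" .
qed (use assms ip_norm_nonneg in auto)

lemma ip_norm_minus_commute:
  assumes "g \<in> H" "h \<in> H"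
  shows "ip_norm ip (\<lambda>x. g x - h x) = ip_norm ip (\<lambda>x. h x - g x)"
  using assms unfolding ip_norm_def
  by (simp add: ip_diff ip_diff_right diff_mem algebra_simps)

lemma ip_norm_triangle:
  assumes "g \<in> H" "h \<in> H" "u \<in> H"
  shows "ip_norm ip (\<lambda>x. g x - u x) \<le> ip_norm ip (\<lambda>x. g x - h x) + ip_norm ip (\<lambda>x. h x - u x)"
  using ip_norm_add_le[OF diff_mem[OF assms(1,2)] diff_mem[OF assms(2,3)]] by simp

end

lemma (in rkhs) evaluation_bound:
  assumes "y \<in> X" "h \<in> H"
  shows "cmod (h y) \<le> ip_norm ip h * ip_norm ip (kernel_fun X K y)"
  using Cauchy_Schwarz[OF assms(2) kernel_mem[OF assms(1)]] reproducing[OF assms] by simp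

section \<open>Weighted power series spaces\<close>

text \<open>  The recursion is the coefficient form of \<open>(\<Sum>n. a n * z ^ n) * (1 - (\<Sum>n. p n * z ^ n)) = 1\<close>;
  the application is \<open>p n = (cmod (b n))\<^sup>2\<close>. In probability it is the renewal equation.\<close>

locale renewal =
  fixes p a :: "nat \<Rightarrow> real"
  assumes p_nonneg: "0 \<le> p n" and p_0: "p 0 = 0" and p_1: "0 < p 1"
    and a_0: "a 0 = 1" and a_rec: "0 < n \<Longrightarrow> a n = (\<Sum>k\<le>n. p k * a (n - k))"
begin

lemma a_pos: "0 < a n"
proof (induction n rule: less_induct)
  case (less n)
  show ?case
  proof (cases n)
    case 0
    then show ?thesis by (simp add: a_0)
  next
    case (Suc m)
    have nn: "0 \<le> p k * a (n - k)" if "k \<in> {..n}" for k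
    proof (cases k)
      case 0
      then show ?thesis by (simp add: p_0)
    next
      case (Suc j)
      then have "0 \<le> a (n - k)" using less[of "n - k"] \<open>n = Suc m\<close> by (simp add: less_imp_le)
      then show ?thesis using p_nonneg[of k] by simp
    qed
    have "0 < p 1 * a (n - 1)" using p_1 less[of "n - 1"] Suc by simp
    also have "\<dots> \<le> (\<Sum>k\<le>n. p k * a (n - k))"
      using member_le_sum[of 1 "{..n}" "\<lambda>k. p k * a (n - k)"] nn Suc by auto
    finally show ?thesis using a_rec[of n] Suc by simp
  qed
qed

lemma a_nonneg: "0 \<le> a n"
  using a_pos[of n] by simp

definition s :: "complex fps" where
  "s = Abs_fps (\<lambda>n. of_real (p n))"

text \<open>  The norm of the Hilbert space with kernel \<open>\<Sum>n. a n * (z * cnj w) ^ n\<close>, cut off at degree \<open>N\<close>.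
  The coefficients of a product up to degree \<open>N\<close> depend only on those of the factors up to
  degree \<open>N\<close>. Estimates for the cut-off norms therefore make sense for all formal power series,
  and a bound that is uniform in \<open>N\<close> proves membership in the space: inverses and limits can be
  formed first and estimated afterwards.\<close>

definition wnorm :: "nat \<Rightarrow> complex fps \<Rightarrow> real" where
  "wnorm N \<alpha> = L2_set (\<lambda>n. cmod (fps_nth \<alpha> n) / sqrt (a n)) {..N}"

definition wbd :: "complex fps \<Rightarrow> real \<Rightarrow> bool" where
  "wbd \<alpha> M \<longleftrightarrow> (\<forall>N. wnorm N \<alpha> \<le> M)"

definition W :: "complex fps set" where
  "W = {\<alpha>. \<exists>M. wbd \<alpha> M}"

lemma wnorm_sq: "(wnorm N \<alpha>)\<^sup>2 = (\<Sum>n\<le>N. (cmod (fps_nth \<alpha> n))\<^sup>2 / a n)"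
  using a_nonneg by (simp add: wnorm_def L2_set_def sum_nonneg power_divide)

lemma wnorm_nonneg: "0 \<le> wnorm N \<alpha>"
  by (simp add: wnorm_def)

lemma wnorm_add: "wnorm N (\<alpha> + \<beta>) \<le> wnorm N \<alpha> + wnorm N \<beta>"
proof -
  have "wnorm N (\<alpha> + \<beta>) \<le>
      L2_set (\<lambda>n. cmod (fps_nth \<alpha> n) / sqrt (a n) + cmod (fps_nth \<beta> n) / sqrt (a n)) {..N}"
    unfolding wnorm_def using a_nonneg
    by (intro L2_set_mono) (auto simp: add_divide_distrib[symmetric] intro!: divide_right_mono norm_triangle_ineq)
  also have "\<dots> \<le> wnorm N \<alpha> + wnorm N \<beta>"
    unfolding wnorm_def by (rule L2_set_triangle_ineq)
  finally show ?thesis .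
qed

lemma wnorm_const_mult: "wnorm N (fps_const c * \<alpha>) = cmod c * wnorm N \<alpha>"
proof -
  have "wnorm N (fps_const c * \<alpha>) = L2_set (\<lambda>n. cmod c * (cmod (fps_nth \<alpha> n) / sqrt (a n))) {..N}"
    by (simp add: wnorm_def norm_mult)
  then show ?thesis by (simp add: L2_set_right_distrib wnorm_def)
qed

lemma wnorm_uminus: "wnorm N (- \<alpha>) = wnorm N \<alpha>"
  by (simp add: wnorm_def)

lemma wnorm_one: "wnorm N 1 = 1"
proof -
  have "(\<Sum>n\<le>N. (cmod (fps_nth 1 n))\<^sup>2 / a n) = (\<Sum>n\<in>{0}. (cmod (fps_nth 1 n))\<^sup>2 / a n)"
    by (rule sum.mono_neutral_right) auto
  then have "(wnorm N 1)\<^sup>2 = 1" by (simp add: wnorm_sq a_0)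
  then show ?thesis using wnorm_nonneg[of N 1] by (simp add: power2_eq_1_iff)
qed

lemma coeff_le_wnorm: "n \<le> N \<Longrightarrow> cmod (fps_nth \<alpha> n) \<le> wnorm N \<alpha> * sqrt (a n)"
  using member_le_L2_set[of "{..N}" n "\<lambda>n. cmod (fps_nth \<alpha> n) / sqrt (a n)"] a_pos[of n]
  by (simp add: wnorm_def field_simps)

lemma wnorm_tendsto:
  assumes "\<And>n. (\<lambda>i. fps_nth (X i) n) \<longlonglongrightarrow> fps_nth \<alpha> n"
  shows "(\<lambda>i. wnorm N (X i)) \<longlonglongrightarrow> wnorm N \<alpha>"
proof -
  have "(\<lambda>i. cmod (fps_nth (X i) n) / sqrt (a n)) \<longlonglongrightarrow> cmod (fps_nth \<alpha> n) / sqrt (a n)" for n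
    using a_pos[of n] by (intro tendsto_intros assms) auto
  then show ?thesis
    unfolding wnorm_def L2_set_def by (intro tendsto_real_sqrt tendsto_sum tendsto_power)
qed

lemma wbdD: "wbd \<alpha> M \<Longrightarrow> wnorm N \<alpha> \<le> M"
  by (simp add: wbd_def)

lemma wbd_nonneg: "wbd \<alpha> M \<Longrightarrow> 0 \<le> M"
  using wnorm_nonneg[of 0 \<alpha>] wbdD[of \<alpha> M 0] by linarith

lemma wbd_mono: "wbd \<alpha> M \<Longrightarrow> M \<le> M' \<Longrightarrow> wbd \<alpha> M'"
  unfolding wbd_def by (meson order_trans)

lemma wbd_add: "wbd \<alpha> M \<Longrightarrow> wbd \<beta> M' \<Longrightarrow> wbd (\<alpha> + \<beta>) (M + M')"
  unfolding wbd_def by (intro allI order_trans[OF wnorm_add] add_mono) auto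

lemma wbd_uminus: "wbd (- \<alpha>) M \<longleftrightarrow> wbd \<alpha> M"
  by (simp add: wbd_def wnorm_uminus)

lemma wbd_minus_commute: "wbd (\<alpha> - \<beta>) M \<longleftrightarrow> wbd (\<beta> - \<alpha>) M"
  using wbd_uminus[of "\<alpha> - \<beta>" M] by simp

lemma wbd_triangle: "wbd (\<alpha> - \<beta>) M \<Longrightarrow> wbd (\<beta> - \<gamma>) M' \<Longrightarrow> wbd (\<alpha> - \<gamma>) (M + M')"
  using wbd_add[of "\<alpha> - \<beta>" M "\<beta> - \<gamma>" M'] by simp

lemma wbd_const_mult: "wbd \<alpha> M \<Longrightarrow> wbd (fps_const c * \<alpha>) (cmod c * M)"
  by (simp add: wbd_def wnorm_const_mult mult_left_mono)

lemma wbd_one: "wbd 1 1"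
  by (simp add: wbd_def wnorm_one)

lemma W_I: "wbd \<alpha> M \<Longrightarrow> \<alpha> \<in> W"
  by (auto simp: W_def)

lemma W_add: "\<alpha> \<in> W \<Longrightarrow> \<beta> \<in> W \<Longrightarrow> \<alpha> + \<beta> \<in> W"
  by (auto simp: W_def intro: wbd_add)

lemma W_uminus: "\<alpha> \<in> W \<Longrightarrow> - \<alpha> \<in> W"
  by (auto simp: W_def wbd_uminus)

lemma W_diff: "\<alpha> \<in> W \<Longrightarrow> \<beta> \<in> W \<Longrightarrow> \<alpha> - \<beta> \<in> W"
  using W_add[OF _ W_uminus, of \<alpha> \<beta>] by simp

lemma W_const_mult: "\<alpha> \<in> W \<Longrightarrow> fps_const c * \<alpha> \<in> W"
  using wbd_const_mult by (auto simp: W_def)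

lemma W_one: "1 \<in> W"
  using wbd_one W_I by blast

text \<open>  The limit is taken coefficientwise; the bounds pass to it because each cut-off norm involves
  finitely many coefficients.\<close>

lemma W_complete:
  fixes X :: "nat \<Rightarrow> complex fps"
  assumes "\<And>e. 0 < e \<Longrightarrow> \<exists>N. \<forall>i\<ge>N. \<forall>j\<ge>N. wbd (X i - X j) e"
  shows "\<exists>\<alpha>. \<forall>e>0. \<exists>N. \<forall>i\<ge>N. wbd (\<alpha> - X i) e"
proof -
  have "convergent (\<lambda>i. fps_nth (X i) n)" for n
  proof -
    have "Cauchy (\<lambda>i. fps_nth (X i) n)"
    proof (rule CauchyI)
      fix e :: real assume e: "0 < e"
      define e' where "e' = e / (2 * sqrt (a n))"
      have "0 < e'" using e a_pos by (simp add: e'_def)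
      then obtain N where N: "\<And>i j. N \<le> i \<Longrightarrow> N \<le> j \<Longrightarrow> wbd (X i - X j) e'"
        using assms by blast
      have "norm (fps_nth (X i) n - fps_nth (X j) n) < e" if "N \<le> i" "N \<le> j" for i j
      proof -
        have "norm (fps_nth (X i) n - fps_nth (X j) n) \<le> wnorm n (X i - X j) * sqrt (a n)"
          using coeff_le_wnorm[of n n "X i - X j"] by simp
        also have "\<dots> \<le> e' * sqrt (a n)"
          using wbdD[OF N[OF that]] a_nonneg by (intro mult_right_mono) auto
        also have "\<dots> < e" using e a_pos[of n] by (simp add: e'_def)
        finally show ?thesis .
      qed
      then show "\<exists>M. \<forall>m\<ge>M. \<forall>n'\<ge>M. norm (fps_nth (X m) n - fps_nth (X n') n) < e" by blast
    qed
    then show ?thesis by (simp add: Cauchy_convergent_iff)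
  qed
  then obtain l where l: "\<And>n. (\<lambda>i. fps_nth (X i) n) \<longlonglongrightarrow> l n"
    unfolding convergent_def by metis
  have "\<exists>N. \<forall>i\<ge>N. wbd (Abs_fps l - X i) e" if e: "0 < e" for e
  proof -
    obtain N where N: "\<And>i j. N \<le> i \<Longrightarrow> N \<le> j \<Longrightarrow> wbd (X i - X j) e"
      using assms[OF e] by blast
    have "wnorm m (Abs_fps l - X i) \<le> e" if i: "N \<le> i" for i m
    proof (rule tendsto_upperbound)
      show "(\<lambda>j. wnorm m (X j - X i)) \<longlonglongrightarrow> wnorm m (Abs_fps l - X i)"
        using l by (intro wnorm_tendsto) (auto intro!: tendsto_intros)
      show "\<forall>\<^sub>F j in sequentially. wnorm m (X j - X i) \<le> e"
        using eventually_ge_at_top[of N] by eventually_elim (use N i wbdD in blast)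
    qed simp
    then show ?thesis unfolding wbd_def by blast
  qed
  then show ?thesis by blast
qed

text \<open>
  Cauchy--Schwarz with the weights \<open>p k * a (n - k)\<close>, whose sum over \<open>k\<close> is exactly \<open>a n\<close>.
\<close>

lemma s_coeff_le:
  "(cmod (fps_nth (s * u) n))\<^sup>2 / a n \<le> (\<Sum>k\<le>n. p k * ((cmod (fps_nth u (n - k)))\<^sup>2 / a (n - k)))"
proof (cases "n = 0")
  case True
  then show ?thesis by (simp add: s_def p_0)
next
  case False
  have "cmod (fps_nth (s * u) n) = cmod (\<Sum>k\<le>n. of_real (p k) * fps_nth u (n - k))"
    by (simp add: fps_mult_nth s_def atLeast0AtMost)
  also have "\<dots> \<le> (\<Sum>k\<le>n. p k * cmod (fps_nth u (n - k)))"
    using p_nonneg by (intro order_trans[OF norm_sum] sum_mono) (simp add: norm_mult)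
  finally have "(cmod (fps_nth (s * u) n))\<^sup>2 \<le> (\<Sum>k\<le>n. p k * cmod (fps_nth u (n - k)))\<^sup>2"
    by (rule power_mono) simp
  also have "\<dots> \<le> (\<Sum>k\<le>n. p k * a (n - k)) *
      (\<Sum>k\<le>n. p k * ((cmod (fps_nth u (n - k)))\<^sup>2 / a (n - k)))"
  proof (rule sum_square_le_product)
    show "(p k * cmod (fps_nth u (n - k)))\<^sup>2 \<le>
      p k * a (n - k) * (p k * ((cmod (fps_nth u (n - k)))\<^sup>2 / a (n - k)))" for k
      using a_pos[of "n - k"] by (simp add: power2_eq_square)
  qed (use p_nonneg a_nonneg in auto)
  also have "(\<Sum>k\<le>n. p k * a (n - k)) = a n" using a_rec False by simp
  finally show ?thesis using a_pos[of n] by (simp add: field_simps)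
qed

end

section \<open>Evaluation of power series\<close>

abbreviation abs_summable_at :: "complex fps \<Rightarrow> complex \<Rightarrow> bool" where
  "abs_summable_at \<alpha> z \<equiv> summable (\<lambda>n. norm (fps_nth \<alpha> n * z ^ n))"

lemma eval_fps_add_abs:
  assumes "abs_summable_at \<alpha> z" "abs_summable_at \<beta> z"
  shows "eval_fps (\<alpha> + \<beta>) z = eval_fps \<alpha> z + eval_fps \<beta> z"
  using suminf_add[OF summable_norm_cancel[OF assms(1)] summable_norm_cancel[OF assms(2)]]
  by (simp add: eval_fps_def algebra_simps)

lemma eval_fps_diff_abs:
  assumes "abs_summable_at \<alpha> z" "abs_summable_at \<beta> z"
  shows "eval_fps (\<alpha> - \<beta>) z = eval_fps \<alpha> z - eval_fps \<beta> z"
  using suminf_diff[OF summable_norm_cancel[OF assms(1)] summable_norm_cancel[OF assms(2)]]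
  by (simp add: eval_fps_def algebra_simps)

lemma eval_fps_const_mult_abs:
  assumes "abs_summable_at \<alpha> z"
  shows "eval_fps (fps_const c * \<alpha>) z = c * eval_fps \<alpha> z"
  using suminf_mult[OF summable_norm_cancel[OF assms], of c]
  by (simp add: eval_fps_def algebra_simps)

lemma eval_fps_mult_abs:
  assumes "abs_summable_at \<alpha> z" "abs_summable_at \<beta> z"
  shows "eval_fps (\<alpha> * \<beta>) z = eval_fps \<alpha> z * eval_fps \<beta> z"
proof -
  have "fps_nth (\<alpha> * \<beta>) n * z ^ n
      = (\<Sum>i\<le>n. (fps_nth \<alpha> i * z ^ i) * (fps_nth \<beta> (n - i) * z ^ (n - i)))" for n
    unfolding fps_mult_nth sum_distrib_right atLeast0AtMost
    by (intro sum.cong refl) (simp add: algebra_simps flip: power_add)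
  then show ?thesis
    using Cauchy_product[OF assms] by (simp add: eval_fps_def)
qed

lemma abs_summable_of_real:
  "summable (\<lambda>n. c n * (norm t) ^ n) \<Longrightarrow> (\<And>n. 0 \<le> c n) \<Longrightarrow>
    abs_summable_at (Abs_fps (\<lambda>n. of_real (c n))) t"
  by (simp add: norm_mult norm_power)

context renewal
begin

definition a_fps :: "complex fps" where
  "a_fps = Abs_fps (\<lambda>n. of_real (a n))"

lemma a_fps_eq: "a_fps = 1 + s * a_fps"
proof (rule fps_ext)
  fix n
  show "fps_nth a_fps n = fps_nth (1 + s * a_fps) n"
  proof (cases "n = 0")
    case True
    then show ?thesis by (simp add: a_fps_def s_def a_0 p_0)
  next
    case False
    then have "fps_nth a_fps n = of_real (\<Sum>k\<le>n. p k * a (n - k))"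
      using a_rec[of n] by (simp add: a_fps_def)
    also have "\<dots> = fps_nth (1 + s * a_fps) n"
      using False by (simp add: a_fps_def s_def fps_mult_nth atLeast0AtMost)
    finally show ?thesis .
  qed
qed

text \<open>  The recursion bounds each partial sum \<open>S\<close> by \<open>1 + q * S\<close>, where \<open>q < 1\<close> is the sum of the series
  of \<open>p\<close>; so \<open>S \<le> 1 / (1 - q)\<close>.\<close>

lemma summable_a:
  assumes t: "0 \<le> t" and sm: "summable (\<lambda>n. p n * t ^ n)" and lt: "(\<Sum>n. p n * t ^ n) < 1"
  shows "summable (\<lambda>n. a n * t ^ n)"
proof (rule summableI_nonneg_bounded)
  define q where "q = (\<Sum>n. p n * t ^ n)"
  have nn: "0 \<le> p n * t ^ n" "0 \<le> a n * t ^ n" for n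
    using t p_nonneg[of n] a_nonneg[of n] by simp_all
  show "0 \<le> a n * t ^ n" for n by (rule nn)
  have bound: "(\<Sum>n\<le>N. a n * t ^ n) \<le> 1 / (1 - q)" for N
  proof -
    let ?S = "\<Sum>n\<le>N. a n * t ^ n"
    have "?S = (\<Sum>n\<le>N. (if n = 0 then 1 else 0) + (\<Sum>k\<le>n. (p k * t ^ k) * (a (n - k) * t ^ (n - k))))"
    proof (rule sum.cong)
      fix n
      show "a n * t ^ n = (if n = 0 then 1 else 0) + (\<Sum>k\<le>n. (p k * t ^ k) * (a (n - k) * t ^ (n - k)))"
      proof (cases "n = 0")
        case False
        then have "a n * t ^ n = (\<Sum>k\<le>n. p k * a (n - k) * t ^ n)"
          using a_rec[of n] by (simp add: sum_distrib_right)
        also have "\<dots> = (\<Sum>k\<le>n. (p k * t ^ k) * (a (n - k) * t ^ (n - k)))"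
          by (intro sum.cong refl) (simp add: algebra_simps flip: power_add)
        finally show ?thesis using False by simp
      qed (simp add: a_0 p_0)
    qed simp
    also have "\<dots> = 1 + (\<Sum>n\<le>N. \<Sum>k\<le>n. (p k * t ^ k) * (a (n - k) * t ^ (n - k)))"
      by (simp add: sum.distrib)
    also have "\<dots> \<le> 1 + (\<Sum>n\<le>N. p n * t ^ n) * ?S"
      using sum_convolution_le[of "\<lambda>n. p n * t ^ n" "\<lambda>n. a n * t ^ n" N] nn by simp
    also have "\<dots> \<le> 1 + q * ?S"
      unfolding q_def using nn sm by (intro add_left_mono mult_right_mono sum_le_suminf sum_nonneg) auto
    finally show ?thesis using lt by (simp add: q_def field_simps)
  qed
  show "(\<Sum>i<n. a i * t ^ i) \<le> 1 / (1 - q)" for n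
    using sum_mono2[of "{..n}" "{..<n}" "\<lambda>i. a i * t ^ i"] nn bound[of n] by force
qed

lemma eval_a_fps:
  assumes sm: "summable (\<lambda>n. p n * (cmod t) ^ n)" and lt: "(\<Sum>n. p n * (cmod t) ^ n) < 1"
  shows "1 / (1 - eval_fps s t) = eval_fps a_fps t"
proof -
  have as: "abs_summable_at s t"
    unfolding s_def using sm p_nonneg by (rule abs_summable_of_real)
  have aa: "abs_summable_at a_fps t"
    unfolding a_fps_def using summable_a[OF _ sm lt] a_nonneg by (intro abs_summable_of_real) auto
  have one: "abs_summable_at 1 t"
    by (rule summable_finite[of "{0}"]) auto
  have eq: "s * a_fps = a_fps - 1" using a_fps_eq by (simp add: algebra_simps)
  have "eval_fps s t * eval_fps a_fps t = eval_fps (a_fps - 1) t"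
    using eval_fps_mult_abs[OF as aa] by (simp add: eq)
  also have "\<dots> = eval_fps a_fps t - 1"
    using eval_fps_diff_abs[OF aa one] by simp
  finally have "(1 - eval_fps s t) * eval_fps a_fps t = 1" by (simp add: algebra_simps)
  then show ?thesis by (metis divide_eq_eq mult.commute mult_zero_left zero_neq_one)
qed

text \<open>  Point evaluation is bounded, with the norm of the reproducing kernel as the bound.\<close>

lemma wbd_eval:
  assumes bd: "wbd \<alpha> M" and sm: "summable (\<lambda>n. a n * ((cmod z)\<^sup>2) ^ n)"
  shows "abs_summable_at \<alpha> z"
    and "cmod (eval_fps \<alpha> z) \<le> M * sqrt (\<Sum>n. a n * ((cmod z)\<^sup>2) ^ n)"
proof -
  let ?S = "\<Sum>n. a n * ((cmod z)\<^sup>2) ^ n"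
  have partial: "(\<Sum>n\<le>N. norm (fps_nth \<alpha> n * z ^ n)) \<le> M * sqrt ?S" for N
  proof (rule power2_le_imp_le)
    have "(\<Sum>n\<le>N. norm (fps_nth \<alpha> n * z ^ n))\<^sup>2
        \<le> (\<Sum>n\<le>N. (cmod (fps_nth \<alpha> n))\<^sup>2 / a n) * (\<Sum>n\<le>N. a n * ((cmod z)\<^sup>2) ^ n)"
    proof (rule sum_square_le_product)
      show "(norm (fps_nth \<alpha> n * z ^ n))\<^sup>2 \<le> (cmod (fps_nth \<alpha> n))\<^sup>2 / a n * (a n * ((cmod z)\<^sup>2) ^ n)" for n
        using a_pos[of n]
        by (simp add: norm_mult norm_power power_mult_distrib flip: power_mult) (simp add: mult.commute)
    qed (use a_nonneg in auto)
    also have "\<dots> \<le> M\<^sup>2 * ?S"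
      unfolding wnorm_sq[symmetric]
      using bd sm a_nonneg
      by (intro mult_mono power_mono wnorm_nonneg sum_le_suminf sum_nonneg) (auto dest: wbdD)
    also have "\<dots> = (M * sqrt ?S)\<^sup>2"
      using sm a_nonneg by (simp add: power_mult_distrib suminf_nonneg)
    finally show "(\<Sum>n\<le>N. norm (fps_nth \<alpha> n * z ^ n))\<^sup>2 \<le> (M * sqrt ?S)\<^sup>2" .
    show "0 \<le> M * sqrt ?S"
      using wbd_nonneg[OF bd] sm a_nonneg by (simp add: suminf_nonneg)
  qed
  have lt: "(\<Sum>i<n. norm (fps_nth \<alpha> i * z ^ i)) \<le> M * sqrt ?S" for n
    by (rule order_trans[OF sum_mono2 partial[of n]]) auto
  show summ: "abs_summable_at \<alpha> z"
    by (rule summableI_nonneg_bounded[OF _ lt]) simp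
  have "cmod (eval_fps \<alpha> z) \<le> (\<Sum>n. norm (fps_nth \<alpha> n * z ^ n))"
    unfolding eval_fps_def by (rule summable_norm[OF summ])
  also have "\<dots> \<le> M * sqrt ?S" by (rule suminf_le_const[OF summ lt])
  finally show "cmod (eval_fps \<alpha> z) \<le> M * sqrt ?S" .
qed

end

section \<open>Contractive multipliers\<close>

context renewal
begin

definition contractive :: "complex fps \<Rightarrow> bool" where
  "contractive \<phi> \<longleftrightarrow> (\<forall>N u. wnorm N (\<phi> * u) \<le> wnorm N u)"

lemma contractiveD: "contractive \<phi> \<Longrightarrow> wnorm N (\<phi> * u) \<le> wnorm N u"
  by (simp add: contractive_def)

lemma contractive_mult: "contractive \<phi> \<Longrightarrow> contractive \<psi> \<Longrightarrow> contractive (\<phi> * \<psi>)"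
  unfolding contractive_def mult.assoc using order_trans by blast

lemma contractive_one: "contractive 1"
  by (simp add: contractive_def)

lemma contractive_prod: "(\<And>i. i \<in> I \<Longrightarrow> contractive (\<phi> i)) \<Longrightarrow> contractive (\<Prod>i\<in>I. \<phi> i)"
  by (induction I rule: infinite_finite_induct) (auto simp: contractive_one contractive_mult)

lemma contractive_wbd: "contractive \<phi> \<Longrightarrow> wbd u M \<Longrightarrow> wbd (\<phi> * u) M"
  unfolding wbd_def by (blast intro: order_trans contractiveD)

lemma contractive_wbd_one: "contractive \<phi> \<Longrightarrow> wbd \<phi> 1"
  using contractive_wbd[of \<phi> 1 1] wbd_one by simp

lemma contractive_W: "contractive \<phi> \<Longrightarrow> u \<in> W \<Longrightarrow> \<phi> * u \<in> W"
  by (auto simp: W_def intro: contractive_wbd)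

lemma contractive_limit:
  assumes con: "\<And>i. contractive (X i)"
    and lim: "\<And>n. (\<lambda>i. fps_nth (X i) n) \<longlonglongrightarrow> fps_nth \<phi> n"
  shows "contractive \<phi>"
  unfolding contractive_def
proof (intro allI)
  fix N u
  have "(\<lambda>i. fps_nth (X i * u) n) \<longlonglongrightarrow> fps_nth (\<phi> * u) n" for n
    unfolding fps_mult_nth by (intro tendsto_intros lim)
  then have "(\<lambda>i. wnorm N (X i * u)) \<longlonglongrightarrow> wnorm N (\<phi> * u)" by (rule wnorm_tendsto)
  then show "wnorm N (\<phi> * u) \<le> wnorm N u"
    by (rule Lim_bounded) (use con contractiveD in blast)
qed

text \<open>  By \<open>s_coeff_le\<close> the squared norm of \<open>s * u\<close> is at most a convolution of \<open>p\<close> with the terms of the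
  squared norm of \<open>u\<close>. If \<open>p n = (cmod (b n))\<^sup>2\<close>, then \<open>s\<close> is the linear functional
  \<open>\<langle>\<cdot>, b\<rangle>\<close> on the ambient ball, restricted to the disc, and its norm is at most \<open>1\<close>.\<close>

lemma contractive_s:
  assumes "\<And>N. (\<Sum>n\<le>N. p n) \<le> 1"
  shows "contractive s"
  unfolding contractive_def
proof (intro allI)
  fix N u
  define v where "v = (\<lambda>n. (cmod (fps_nth u n))\<^sup>2 / a n)"
  have v: "0 \<le> v n" for n using a_nonneg by (simp add: v_def)
  have "(wnorm N (s * u))\<^sup>2 \<le> (\<Sum>n\<le>N. \<Sum>k\<le>n. p k * v (n - k))"
    unfolding wnorm_sq v_def by (intro sum_mono s_coeff_le)
  also have "\<dots> \<le> (\<Sum>n\<le>N. p n) * (\<Sum>n\<le>N. v n)"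
    using p_nonneg v by (rule sum_convolution_le)
  also have "\<dots> \<le> 1 * (\<Sum>n\<le>N. v n)"
    using v by (intro mult_right_mono assms sum_nonneg)
  also have "\<dots> = (wnorm N u)\<^sup>2" by (simp add: wnorm_sq v_def)
  finally show "wnorm N (s * u) \<le> wnorm N u" by (rule power2_le_imp_le) (rule wnorm_nonneg)
qed

text \<open>  The disc automorphism \<open>y \<mapsto> (x - y) / (1 - x * y)\<close> applied to \<open>s\<close>. The inverse exists as a formal
  power series because \<open>s\<close> has no constant term.\<close>

definition blaschke :: "real \<Rightarrow> complex fps" where
  "blaschke x = (fps_const (of_real x) - s) * inverse (1 - fps_const (of_real x) * s)"

lemma inverse_one_minus_xs: "inverse (1 - fps_const c * s) * (1 - fps_const c * s) = 1"
  by (rule inverse_mult_eq_1) (simp add: s_def p_0)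

text \<open>  A disc automorphism of a contraction is a contraction: with \<open>h = (1 - x * s) * u\<close> the claim reads
  \<open>\<parallel>(x - s) * u\<parallel> \<le> \<parallel>(1 - x * s) * u\<parallel>\<close>, and the squares of these norms differ by
  \<open>(1 - x\<^sup>2) * (\<parallel>u\<parallel>\<^sup>2 - \<parallel>s * u\<parallel>\<^sup>2)\<close>.\<close>

lemma contractive_blaschke:
  assumes con: "contractive s" and x: "0 \<le> x" "x \<le> 1"
  shows "contractive (blaschke x)"
  unfolding contractive_def
proof (intro allI)
  fix N h
  define c where "c = (of_real x :: complex)"
  define u where "u = inverse (1 - fps_const c * s) * h"
  have h: "h = u - fps_const c * (s * u)"
  proof -
    have "h = inverse (1 - fps_const c * s) * (1 - fps_const c * s) * h"
      by (simp only: inverse_one_minus_xs mult_1)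
    also have "\<dots> = u - fps_const c * (s * u)" by (simp add: u_def algebra_simps)
    finally show ?thesis .
  qed
  have Bh: "blaschke x * h = fps_const c * u - s * u"
    by (simp add: blaschke_def c_def u_def algebra_simps)
  have identity: "(cmod (c * y - w))\<^sup>2 + (1 - x\<^sup>2) * ((cmod y)\<^sup>2 - (cmod w)\<^sup>2) = (cmod (y - c * w))\<^sup>2" for y w
    unfolding c_def cmod_power2 by (simp add: power2_eq_square algebra_simps)
  have "(wnorm N h)\<^sup>2 = (wnorm N (blaschke x * h))\<^sup>2 + (1 - x\<^sup>2) * ((wnorm N u)\<^sup>2 - (wnorm N (s * u))\<^sup>2)"
    unfolding wnorm_sq Bh
    by (subst h) (simp add: identity[symmetric] add_divide_distrib sum.distrib sum_distrib_left
        diff_divide_distrib sum_subtractf right_diff_distrib)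
  moreover have "(wnorm N (s * u))\<^sup>2 \<le> (wnorm N u)\<^sup>2"
    by (intro power_mono contractiveD con wnorm_nonneg)
  moreover have "x\<^sup>2 \<le> 1" using x by (simp add: power_le_one)
  ultimately have "(wnorm N (blaschke x * h))\<^sup>2 \<le> (wnorm N h)\<^sup>2" by simp
  then show "wnorm N (blaschke x * h) \<le> wnorm N h" by (rule power2_le_imp_le) (rule wnorm_nonneg)
qed

end

section \<open>Infinite Blaschke products\<close>

text \<open>  If one of two points is much closer to \<open>1\<close> than the other, then their pseudo-hyperbolic distance
  is almost \<open>1\<close>: with \<open>d = 1 - x\<close> and \<open>e = 1 - y\<close> it is at least \<open>\<bar>d - e\<bar> / (d + e)\<close>.\<close>

lemma pseudo_hyperbolic_lower_bound:
  fixes x y \<epsilon> :: real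
  assumes "0 \<le> x" "x < 1" "0 \<le> y" "y < 1"
    and "1 - x \<le> \<epsilon> * (1 - y) \<or> 1 - y \<le> \<epsilon> * (1 - x)" and "0 \<le> \<epsilon>"
  shows "1 - 2 * \<epsilon> \<le> \<bar>(x - y) / (1 - x * y)\<bar>"
proof -
  have pos: "0 < 1 - x * y"
    using assms mult_strict_mono[of x 1 y 1] by (cases "y = 0") auto
  define d e where "d = 1 - x" and "e = 1 - y"
  have de: "0 < d" "0 < e" "x = 1 - d" "y = 1 - e" using assms by (auto simp: d_def e_def)
  have bound: "(1 - 2 * \<epsilon>) * (d + e) \<le> \<bar>d - e\<bar>"
  proof (cases "d \<le> \<epsilon> * e")
    case True
    have "(1 - 2 * \<epsilon>) * (d + e) = d + e - 2 * (\<epsilon> * e) - 2 * \<epsilon> * d" by (simp add: algebra_simps)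
    also have "\<dots> \<le> d + e - 2 * d - 0"
      using True de assms(6) by (intro diff_mono) auto
    finally show ?thesis by linarith
  next
    case False
    then have e: "e \<le> \<epsilon> * d" using assms(5) by (simp add: d_def e_def)
    have "(1 - 2 * \<epsilon>) * (d + e) = d + e - 2 * (\<epsilon> * d) - 2 * \<epsilon> * e" by (simp add: algebra_simps)
    also have "\<dots> \<le> d + e - 2 * e - 0"
      using e de assms(6) by (intro diff_mono) auto
    finally show ?thesis by linarith
  qed
  have "(1 - 2 * \<epsilon>) * (1 - x * y) \<le> \<bar>d - e\<bar>"
  proof (cases "1 - 2 * \<epsilon> \<ge> 0")
    case True
    have "1 - x * y = d + e - d * e" by (subst de(3), subst de(4)) (simp add: algebra_simps)
    also have "\<dots> \<le> d + e" using de by simp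
    finally have "1 - x * y \<le> d + e" .
    then show ?thesis by (rule order_trans[OF mult_left_mono[OF _ True] bound])
  next
    case False
    then have "(1 - 2 * \<epsilon>) * (1 - x * y) \<le> 0" using pos by (simp add: mult_nonpos_nonneg)
    then show ?thesis by linarith
  qed
  moreover have "\<bar>x - y\<bar> = \<bar>d - e\<bar>" using de by simp
  ultimately show ?thesis using pos by (simp add: abs_divide pos_le_divide_eq)
qed

context renewal
begin

lemma a_le_1:
  assumes "\<And>N. (\<Sum>n\<le>N. p n) \<le> 1"
  shows "a n \<le> 1"
proof (induction n rule: less_induct)
  case (less n)
  show ?case
  proof (cases "n = 0")
    case False
    then have "a n = (\<Sum>k\<le>n. p k * a (n - k))" by (simp add: a_rec)
    also have "\<dots> \<le> (\<Sum>k\<le>n. p k)"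
    proof (rule sum_mono)
      fix k
      show "p k * a (n - k) \<le> p k"
        using less[of "n - k"] False p_nonneg[of k] p_0 by (cases "k = 0") (auto intro: mult_left_le)
    qed
    also have "\<dots> \<le> 1" by (rule assms)
    finally show ?thesis .
  qed (simp add: a_0)
qed

lemma contractive_coeff_le:
  assumes "\<And>N. (\<Sum>n\<le>N. p n) \<le> 1" "contractive \<phi>"
  shows "cmod (fps_nth \<phi> n) \<le> 1"
proof -
  have "cmod (fps_nth \<phi> n) \<le> wnorm n \<phi> * sqrt (a n)" by (rule coeff_le_wnorm) simp
  also have "\<dots> \<le> 1 * 1"
    using wbdD[OF contractive_wbd_one[OF assms(2)]] a_le_1[OF assms(1)] a_nonneg
    by (intro mult_mono) auto
  finally show ?thesis by simp
qed

lemma contractive_abs_summable: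
  assumes "\<And>N. (\<Sum>n\<le>N. p n) \<le> 1" "contractive \<phi>" "cmod z < 1"
  shows "abs_summable_at \<phi> z"
proof (rule summable_comparison_test')
  show "summable (\<lambda>n. cmod z ^ n)" using assms(3) by simp
  show "norm (norm (fps_nth \<phi> n * z ^ n)) \<le> cmod z ^ n" for n
    using contractive_coeff_le[OF assms(1,2), of n]
    by (simp add: norm_mult norm_power mult_left_le_one_le)
qed

lemma eval_blaschke:
  assumes p: "\<And>N. (\<Sum>n\<le>N. p n) \<le> 1" and z: "cmod z < 1"
    and x: "0 \<le> x" "x < 1" and y: "eval_fps s z = of_real y" "0 \<le> y" "y < 1"
  shows "eval_fps (blaschke x) z = of_real ((x - y) / (1 - x * y))"
proof -
  let ?c = "fps_const (of_real x) :: complex fps"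
  note as = contractive_abs_summable[OF p _ z]
  have s: "abs_summable_at s z" using as contractive_s[OF p] by blast
  have one: "abs_summable_at 1 z" using as contractive_one by blast
  have xs: "abs_summable_at (?c * s) z"
    using summable_mult[OF s, of x] x by (simp add: norm_mult mult.assoc)
  have c: "abs_summable_at ?c z"
    by (rule summable_finite[of "{0}"]) auto
  have "abs_summable_at (1 - ?c * s) z"
    by (rule summable_comparison_test'[OF summable_add[OF one xs]])
      (auto simp: left_diff_distrib intro: norm_triangle_ineq4)
  moreover have "abs_summable_at (blaschke x) z"
    using as contractive_blaschke[OF contractive_s[OF p]] x by simp
  moreover have "blaschke x * (1 - ?c * s) = ?c - s"
    unfolding blaschke_def mult.assoc inverse_one_minus_xs by simp
  ultimately have "eval_fps (blaschke x) z * eval_fps (1 - ?c * s) z = eval_fps (?c - s) z"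
    using eval_fps_mult_abs[of "blaschke x" z "1 - ?c * s"] by simp
  moreover have "eval_fps (1 - ?c * s) z = of_real (1 - x * y)"
    using eval_fps_diff_abs[OF one xs] eval_fps_const_mult_abs[OF s] y by simp
  moreover have "eval_fps (?c - s) z = of_real (x - y)"
    using eval_fps_diff_abs[OF c s] y by simp
  moreover have "1 - x * y \<noteq> 0"
    using x y mult_strict_mono[of x 1 y 1] by (cases "y = 0") auto
  ultimately show ?thesis by (simp add: eq_divide_eq flip: of_real_mult)
qed

text \<open>  Coefficients of contractive series lie in the closed unit disc, so a diagonal argument applies.
  Partial products of Blaschke factors thus have a limit along a subsequence, whatever the zeros.\<close>

lemma contractive_seq_subconvergent:
  assumes p: "\<And>N. (\<Sum>n\<le>N. p n) \<le> 1" and con: "\<And>i::nat. contractive (X i)"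
  obtains \<sigma> :: "nat \<Rightarrow> nat" and \<phi> where "strict_mono \<sigma>"
    "\<And>n. (\<lambda>i. fps_nth (X (\<sigma> i)) n) \<longlonglongrightarrow> fps_nth \<phi> n"
proof -
  define P where "P n \<tau> = convergent (\<lambda>i. fps_nth (X (\<tau> i)) n)" for n and \<tau> :: "nat \<Rightarrow> nat"
  interpret subseqs P
  proof
    fix n :: nat and \<tau> :: "nat \<Rightarrow> nat"
    have "bounded (range (\<lambda>i. fps_nth (X (\<tau> i)) n))"
      using contractive_coeff_le[OF p con] by (intro boundedI[of _ 1]) auto
    then obtain l r where "strict_mono r" "((\<lambda>i. fps_nth (X (\<tau> i)) n) \<circ> r) \<longlonglongrightarrow> l"
      using bounded_imp_convergent_subsequence by blast
    then show "\<exists>r. strict_mono r \<and> P n (\<tau> \<circ> r)"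
      unfolding P_def convergent_def by (auto simp: o_def)
  qed
  have "P n (\<tau> \<circ> r)" if "strict_mono r" "P n \<tau>" for r n \<tau>
    using that convergent_subseq_convergent[of "\<lambda>i. fps_nth (X (\<tau> i)) n" r]
    by (simp add: P_def o_def)
  then have "P n (diagseq \<circ> ((+) (Suc n)))" for n
    by (rule diagseq_holds)
  then have "convergent (\<lambda>i. fps_nth (X (diagseq (i + Suc n))) n)" for n
    by (simp add: P_def o_def add.commute[of _ n])
  then have "convergent (\<lambda>i. fps_nth (X (diagseq i)) n)" for n
    using convergent_ignore_initial_segment[of "\<lambda>i. fps_nth (X (diagseq i)) n" "Suc n"] by blast
  then obtain l where l: "\<And>n. (\<lambda>i. fps_nth (X (diagseq i)) n) \<longlonglongrightarrow> l n"
    unfolding convergent_def by metis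
  show thesis
    by (rule that[of diagseq "Abs_fps l"]) (use l subseq_diagseq in auto)
qed

lemma contractive_limit_eval:
  assumes p: "\<And>N. (\<Sum>n\<le>N. p n) \<le> 1" and con: "\<And>i::nat. contractive (X i)"
    and lim: "\<And>n. (\<lambda>i. fps_nth (X i) n) \<longlonglongrightarrow> fps_nth \<phi> n" and z: "cmod z < 1"
  shows "(\<lambda>i. eval_fps (X i) z) \<longlonglongrightarrow> eval_fps \<phi> z"
proof -
  have "cmod (fps_nth (X i) k * z ^ k) \<le> cmod z ^ k" for k i
    using contractive_coeff_le[OF p con, of i k]
    by (simp add: norm_mult norm_power mult_left_le_one_le)
  then have "((\<lambda>i. \<Sum>k. fps_nth (X i) k * z ^ k) \<longlongrightarrow> (\<Sum>k. fps_nth \<phi> k * z ^ k)) sequentially"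
    using z lim
    by (intro conjunct2[OF conjunct2[OF tannerys_theorem[where M = "\<lambda>k. cmod z ^ k"]]])
      (auto intro!: tendsto_intros always_eventually)
  then show ?thesis by (simp add: eval_fps_def)
qed

text \<open>  The Blaschke product with zeros where \<open>s\<close> takes one of the values \<open>v 1, v 3, \<dots>\<close>. The decay
  condition makes the \<open>j\<close>-th factor at the value \<open>v (2 * i)\<close> at least \<open>1 - 2 * (1 / 2) ^ (j + 4)\<close> in
  modulus, whatever \<open>i\<close> is, so all partial products are at least \<open>1 / 2\<close> there.\<close>

lemma contractive_oscillating:
  assumes p: "\<And>N. (\<Sum>n\<le>N. p n) \<le> 1"
    and v: "\<And>k. 0 \<le> v k" "\<And>k. v k < 1"
    and decay: "\<And>k. 1 - v (Suc k) \<le> (1 - v k) / 2 ^ (k + 4)"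
  obtains \<phi> where "contractive \<phi>"
    "\<And>z j. cmod z < 1 \<Longrightarrow> eval_fps s z = of_real (v (2 * j + 1)) \<Longrightarrow> eval_fps \<phi> z = 0"
    "\<And>z j. cmod z < 1 \<Longrightarrow> eval_fps s z = of_real (v (2 * j)) \<Longrightarrow> 1 / 2 \<le> cmod (eval_fps \<phi> z)"
proof -
  define X where "X N = (\<Prod>j<N. blaschke (v (2 * j + 1)))" for N
  have con: "contractive (X N)" for N
    unfolding X_def using v
    by (intro contractive_prod contractive_blaschke contractive_s p) (auto intro: less_imp_le)
  obtain \<sigma> \<phi> where \<sigma>: "strict_mono \<sigma>" and lim: "\<And>n. (\<lambda>i. fps_nth (X (\<sigma> i)) n) \<longlonglongrightarrow> fps_nth \<phi> n"
    by (rule contractive_seq_subconvergent[of X, OF p con]) blast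
  have eval_X: "eval_fps (X N) z = of_real (\<Prod>j<N. (v (2 * j + 1) - y) / (1 - v (2 * j + 1) * y))"
    if "cmod z < 1" "eval_fps s z = of_real y" "0 \<le> y" "y < 1" for N z y
  proof (induction N)
    case 0
    show ?case by (simp add: X_def)
  next
    case (Suc N)
    have "contractive (blaschke (v (2 * N + 1)))"
      using v by (intro contractive_blaschke contractive_s p) (auto intro: less_imp_le)
    then have "eval_fps (X N * blaschke (v (2 * N + 1))) z
        = eval_fps (X N) z * eval_fps (blaschke (v (2 * N + 1))) z"
      using that con by (intro eval_fps_mult_abs contractive_abs_summable[OF p])
    also have "\<dots> = of_real (\<Prod>j<Suc N. (v (2 * j + 1) - y) / (1 - v (2 * j + 1) * y))"
      using eval_blaschke[OF p, of z "v (2 * N + 1)" y] that v Suc by simp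
    finally show ?case by (simp add: X_def)
  qed
  have limit: "(\<lambda>i. eval_fps (X (\<sigma> i)) z) \<longlonglongrightarrow> eval_fps \<phi> z" if "cmod z < 1" for z
    using p con lim that by (rule contractive_limit_eval)
  have mono: "1 - v (Suc k) \<le> 1 - v k" for k
  proof -
    have "(1 - v k) / 2 ^ (k + 4) \<le> (1 - v k) / 1"
      using v(2)[of k] by (intro divide_left_mono) (auto intro: one_le_power)
    then show ?thesis using decay[of k] by simp
  qed
  have anti: "1 - v l \<le> 1 - v k" if "k \<le> l" for k l
    using that mono by (rule lift_Suc_antimono_le[of "\<lambda>k. 1 - v k", rotated])
  have decay': "1 - v l \<le> (1 / 2) ^ (j + 4) * (1 - v k)" if "k < l" "j \<le> k" for j k l
  proof -
    have "1 - v l \<le> 1 - v (Suc k)" using anti[of "Suc k" l] that by simp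
    also have "\<dots> \<le> (1 / 2) ^ (k + 4) * (1 - v k)"
      using decay[of k] by (simp add: power_one_over field_simps)
    also have "\<dots> \<le> (1 / 2) ^ (j + 4) * (1 - v k)"
      using v(2)[of k] that by (intro mult_right_mono power_decreasing) auto
    finally show ?thesis .
  qed
  show thesis
  proof
    show "contractive \<phi>" using con lim by (rule contractive_limit)
  next
    fix z j assume z: "cmod z < 1" "eval_fps s z = of_real (v (2 * j + 1))"
    have zero: "eval_fps (X N) z = 0" if "j < N" for N
      using eval_X[OF z v] that by (auto intro!: prod_zero bexI[of _ j])
    have "eval_fps (X (\<sigma> i)) z = 0" if "j < i" for i
      using seq_suble[OF \<sigma>, of i] that by (intro zero) simp
    then have "\<forall>\<^sub>F i in sequentially. eval_fps (X (\<sigma> i)) z = 0"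
      by (rule eventually_mono[OF eventually_gt_at_top[of j]])
    then have "(\<lambda>i. eval_fps (X (\<sigma> i)) z) \<longlonglongrightarrow> 0" by (rule tendsto_eventually)
    with limit[OF z(1)] show "eval_fps \<phi> z = 0" by (rule LIMSEQ_unique)
  next
    fix z i assume z: "cmod z < 1" "eval_fps s z = of_real (v (2 * i))"
    have "1 / 2 \<le> cmod (eval_fps (X N) z)" for N
    proof -
      let ?q = "\<lambda>j. (v (2 * j + 1) - v (2 * i)) / (1 - v (2 * j + 1) * v (2 * i))"
      let ?e = "\<lambda>j. 2 * (1 / 2) ^ (j + 4) :: real"
      have e01: "?e j \<in> {0..1}" for j
      proof -
        have "?e j = (1 / 2) ^ (j + 3)" by (simp add: power_add eval_nat_numeral)
        then show ?thesis using power_le_one[of "1 / 2 :: real" "j + 3"] by simp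
      qed
      have "(\<Sum>j<N. ?e j) = 1 / 8 * (\<Sum>j<N. (1 / 2) ^ j)"
        unfolding sum_distrib_left by (intro sum.cong refl) (simp add: power_add power4_eq_xxxx)
      also have "\<dots> \<le> 1 / 2"
      proof -
        have "(\<Sum>j<N. (1 / 2) ^ j) = (1 - (1 / 2) ^ N) / (1 - 1 / 2 :: real)"
          by (simp add: sum_gp_strict)
        also have "\<dots> = 2 - 2 * (1 / 2) ^ N" by simp
        also have "\<dots> \<le> 4" using zero_le_power[of "1 / 2 :: real" N] by linarith
        finally show ?thesis by simp
      qed
      finally have "1 / 2 \<le> 1 - (\<Sum>j<N. ?e j)" by simp
      also have "\<dots> \<le> (\<Prod>j<N. 1 - ?e j)"
        using e01 by (intro Weierstrass_prod_ineq)
      also have "\<dots> \<le> (\<Prod>j<N. \<bar>?q j\<bar>)"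
      proof (rule prod_mono)
        fix j
        have "1 - ?e j \<le> \<bar>?q j\<bar>"
        proof (rule pseudo_hyperbolic_lower_bound)
          show "1 - v (2 * j + 1) \<le> (1 / 2) ^ (j + 4) * (1 - v (2 * i)) \<or>
              1 - v (2 * i) \<le> (1 / 2) ^ (j + 4) * (1 - v (2 * j + 1))"
          proof (cases "i \<le> j")
            case True
            have "1 - v (2 * j + 1) \<le> (1 / 2) ^ (j + 4) * (1 - v (2 * j))" by (rule decay') auto
            also have "\<dots> \<le> (1 / 2) ^ (j + 4) * (1 - v (2 * i))"
              using anti[of "2 * i" "2 * j"] True by (intro mult_left_mono) auto
            finally show ?thesis by blast
          next
            case False
            then show ?thesis using decay'[of "2 * j + 1" "2 * i" j] by auto
          qed
        qed (use v in auto)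
        then show "0 \<le> 1 - ?e j \<and> 1 - ?e j \<le> \<bar>?q j\<bar>"
          using e01[of j] by simp
      qed
      also have "\<dots> = cmod (eval_fps (X N) z)"
        unfolding eval_X[OF z v] norm_of_real by (simp add: abs_prod)
      finally show ?thesis .
    qed
    then show "1 / 2 \<le> cmod (eval_fps \<phi> z)"
      using tendsto_norm[OF limit[OF z(1)]] by (intro tendsto_lowerbound[where F = sequentially]) auto
  qed
qed

end

section \<open>Characters of the weighted algebra\<close>

locale renewal_algebra = renewal +
  fixes C :: real
  assumes convolution_bound: "(\<Sum>k\<le>n. a k * a (n - k)) \<le> C * a n"
begin

lemma C_ge_1: "1 \<le> C"
  using convolution_bound[of 0] by (simp add: a_0)

text \<open>  Cauchy--Schwarz with the weights \<open>a k * a (n - k)\<close>; the assumption bounds their sum over \<open>k\<close>.\<close>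

lemma wnorm_mult: "wnorm N (\<alpha> * \<beta>) \<le> sqrt C * wnorm N \<alpha> * wnorm N \<beta>"
proof (rule power2_le_imp_le)
  define u v where "u n = (cmod (fps_nth \<alpha> n))\<^sup>2 / a n" and "v n = (cmod (fps_nth \<beta> n))\<^sup>2 / a n" for n
  have uv: "0 \<le> u n" "0 \<le> v n" for n using a_nonneg by (simp_all add: u_def v_def)
  have "(cmod (fps_nth (\<alpha> * \<beta>) n))\<^sup>2 / a n \<le> C * (\<Sum>k\<le>n. u k * v (n - k))" for n
  proof -
    have "cmod (fps_nth (\<alpha> * \<beta>) n) \<le> (\<Sum>k\<le>n. cmod (fps_nth \<alpha> k) * cmod (fps_nth \<beta> (n - k)))"
      by (simp add: fps_mult_nth atLeast0AtMost norm_mult order_trans[OF norm_sum])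
    then have "(cmod (fps_nth (\<alpha> * \<beta>) n))\<^sup>2 \<le> (\<Sum>k\<le>n. cmod (fps_nth \<alpha> k) * cmod (fps_nth \<beta> (n - k)))\<^sup>2"
      by (rule power_mono) simp
    also have "\<dots> \<le> (\<Sum>k\<le>n. a k * a (n - k)) * (\<Sum>k\<le>n. u k * v (n - k))"
    proof (rule sum_square_le_product)
      show "(cmod (fps_nth \<alpha> k) * cmod (fps_nth \<beta> (n - k)))\<^sup>2 \<le> a k * a (n - k) * (u k * v (n - k))" for k
        using a_pos[of k] a_pos[of "n - k"] by (simp add: u_def v_def power_mult_distrib)
    qed (use uv a_nonneg in auto)
    also have "\<dots> \<le> C * a n * (\<Sum>k\<le>n. u k * v (n - k))"
      using uv by (intro mult_right_mono convolution_bound sum_nonneg) auto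
    finally show ?thesis using a_pos[of n] by (simp add: field_simps)
  qed
  then have "(wnorm N (\<alpha> * \<beta>))\<^sup>2 \<le> C * (\<Sum>n\<le>N. \<Sum>k\<le>n. u k * v (n - k))"
    unfolding wnorm_sq sum_distrib_left by (intro sum_mono)
  also have "\<dots> \<le> C * ((\<Sum>n\<le>N. u n) * (\<Sum>n\<le>N. v n))"
    using C_ge_1 uv by (intro mult_left_mono sum_convolution_le) auto
  also have "\<dots> = (sqrt C * wnorm N \<alpha> * wnorm N \<beta>)\<^sup>2"
    using C_ge_1 by (simp add: power_mult_distrib wnorm_sq u_def v_def)
  finally show "(wnorm N (\<alpha> * \<beta>))\<^sup>2 \<le> (sqrt C * wnorm N \<alpha> * wnorm N \<beta>)\<^sup>2" .
  show "0 \<le> sqrt C * wnorm N \<alpha> * wnorm N \<beta>"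
    using C_ge_1 wnorm_nonneg by simp
qed

lemma W_mult:
  assumes "\<alpha> \<in> W" "\<beta> \<in> W"
  shows "\<alpha> * \<beta> \<in> W"
proof -
  obtain K L where K: "wbd \<alpha> K" and L: "wbd \<beta> L" using assms by (auto simp: W_def)
  have "wnorm N (\<alpha> * \<beta>) \<le> sqrt C * K * L" for N
    using wnorm_mult[of N \<alpha> \<beta>] wbdD[OF K] wbdD[OF L] C_ge_1 wnorm_nonneg wbd_nonneg[OF K]
    by (intro order_trans[OF wnorm_mult] mult_mono mult_nonneg_nonneg) auto
  then show ?thesis using W_I[of "\<alpha> * \<beta>" "sqrt C * K * L"] by (simp add: wbd_def)
qed

text \<open>  The identity \<open>u = 1 + \<alpha> * u\<close> for \<open>u = inverse (1 - \<alpha>)\<close> bounds the cut-off norms of \<open>u\<close>; no Neumann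
  series has to be summed.\<close>

lemma W_inverse:
  assumes bd: "wbd \<alpha> M" and small: "sqrt C * M < 1"
  shows "inverse (1 - \<alpha>) \<in> W" "(1 - \<alpha>) * inverse (1 - \<alpha>) = 1"
proof -
  let ?u = "inverse (1 - \<alpha>)"
  have "cmod (fps_nth \<alpha> 0) \<le> M"
    using coeff_le_wnorm[of 0 0 \<alpha>] wbdD[OF bd, of 0] by (simp add: a_0)
  also have "\<dots> \<le> sqrt C * M"
    using mult_right_mono[of 1 "sqrt C" M] C_ge_1 wbd_nonneg[OF bd] by simp
  finally have "cmod (fps_nth \<alpha> 0) < 1" using small by simp
  then have "fps_nth (1 - \<alpha>) 0 \<noteq> 0" by auto
  then show inv: "(1 - \<alpha>) * ?u = 1" by (rule inverse_mult_eq_1')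
  have u: "?u = 1 + \<alpha> * ?u" using inv by (simp add: algebra_simps)
  have "wnorm N ?u \<le> 1 / (1 - sqrt C * M)" for N
  proof -
    have "wnorm N ?u \<le> wnorm N 1 + wnorm N (\<alpha> * ?u)"
      using wnorm_add[of N 1 "\<alpha> * ?u"] u by simp
    also have "\<dots> \<le> 1 + sqrt C * wnorm N \<alpha> * wnorm N ?u"
      using wnorm_mult[of N \<alpha> ?u] by (simp add: wnorm_one)
    also have "\<dots> \<le> 1 + sqrt C * M * wnorm N ?u"
      using wbdD[OF bd] C_ge_1 wnorm_nonneg by (intro add_left_mono mult_right_mono mult_left_mono) auto
    finally show ?thesis using small by (simp add: field_simps)
  qed
  then show "?u \<in> W" by (intro W_I) (auto simp: wbd_def)
qed

definition character :: "(complex fps \<Rightarrow> complex) \<Rightarrow> bool" where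
  "character \<xi> \<longleftrightarrow> \<xi> 1 = 1 \<and>
     (\<forall>\<alpha>\<in>W. \<forall>\<beta>\<in>W. \<xi> (\<alpha> + \<beta>) = \<xi> \<alpha> + \<xi> \<beta>) \<and>
     (\<forall>\<alpha>\<in>W. \<forall>c. \<xi> (fps_const c * \<alpha>) = c * \<xi> \<alpha>) \<and>
     (\<forall>\<alpha>\<in>W. \<forall>\<beta>\<in>W. \<xi> (\<alpha> * \<beta>) = \<xi> \<alpha> * \<xi> \<beta>)"

lemma characterD:
  assumes "character \<xi>"
  shows "\<xi> 1 = 1"
    and "\<alpha> \<in> W \<Longrightarrow> \<beta> \<in> W \<Longrightarrow> \<xi> (\<alpha> + \<beta>) = \<xi> \<alpha> + \<xi> \<beta>"
    and "\<alpha> \<in> W \<Longrightarrow> \<xi> (fps_const c * \<alpha>) = c * \<xi> \<alpha>"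
    and "\<alpha> \<in> W \<Longrightarrow> \<beta> \<in> W \<Longrightarrow> \<xi> (\<alpha> * \<beta>) = \<xi> \<alpha> * \<xi> \<beta>"
  using assms by (auto simp: character_def)

text \<open>  The Banach algebra argument: if \<open>\<alpha> / \<xi> \<alpha>\<close> were small in norm, then \<open>1 - \<alpha> / \<xi> \<alpha>\<close> would be
  invertible, although \<open>\<xi>\<close> maps it to \<open>0\<close>.\<close>

lemma character_bound:
  assumes \<xi>: "character \<xi>" and bd: "wbd \<alpha> M"
  shows "cmod (\<xi> \<alpha>) \<le> sqrt C * M"
proof (rule ccontr)
  assume "\<not> ?thesis"
  then have big: "sqrt C * M < cmod (\<xi> \<alpha>)" by simp
  have \<alpha>: "\<alpha> \<in> W" using bd by (rule W_I)
  have pos: "0 < cmod (\<xi> \<alpha>)"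
    using big wbd_nonneg[OF bd] C_ge_1 by (smt (verit) mult_nonneg_nonneg real_sqrt_ge_zero)
  define \<beta> where "\<beta> = fps_const (1 / \<xi> \<alpha>) * \<alpha>"
  have "wbd \<beta> (cmod (1 / \<xi> \<alpha>) * M)"
    unfolding \<beta>_def using bd by (rule wbd_const_mult)
  moreover have "sqrt C * (cmod (1 / \<xi> \<alpha>) * M) < 1"
    using big pos by (simp add: norm_divide field_simps)
  ultimately have inv: "inverse (1 - \<beta>) \<in> W" "(1 - \<beta>) * inverse (1 - \<beta>) = 1"
    by (rule W_inverse)+
  have eq: "1 - \<beta> = 1 + fps_const (- (1 / \<xi> \<alpha>)) * \<alpha>"
    by (rule fps_ext) (simp add: \<beta>_def)
  have "\<xi> (1 - \<beta>) = 1 + (- (1 / \<xi> \<alpha>)) * \<xi> \<alpha>"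
    unfolding eq using characterD(1-3)[OF \<xi>] W_one \<alpha> W_const_mult by metis
  then have "\<xi> (1 - \<beta>) = 0" using pos by simp
  moreover have "1 - \<beta> \<in> W"
    unfolding eq by (intro W_add W_one W_const_mult \<alpha>)
  ultimately have "\<xi> ((1 - \<beta>) * inverse (1 - \<beta>)) = 0"
    using characterD(4)[OF \<xi>] inv(1) by simp
  then show False using inv(2) characterD(1)[OF \<xi>] by simp
qed

lemma W_X: "fps_X \<in> W"
proof -
  have "(wnorm N fps_X)\<^sup>2 \<le> (1 / sqrt (a 1))\<^sup>2" for N
  proof -
    have "(wnorm N fps_X)\<^sup>2 = (\<Sum>n\<in>{..N} \<inter> {1}. 1 / a n)"
      unfolding wnorm_sq by (rule sum.mono_neutral_cong_right) auto
    also have "\<dots> \<le> 1 / a 1"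
      using a_nonneg[of 1] by (cases "1 \<le> N") auto
    finally show ?thesis using a_nonneg[of 1] by (simp add: power_divide)
  qed
  then have "wbd fps_X (1 / sqrt (a 1))"
    unfolding wbd_def using a_nonneg[of 1] by (auto intro: power2_le_imp_le)
  then show ?thesis by (rule W_I)
qed

lemma W_X_power: "fps_X ^ k \<in> W"
  by (induction k) (auto intro: W_one W_mult W_X)

lemma W_sum_X: "(\<Sum>k<m. fps_const (c k) * fps_X ^ k) \<in> W"
proof (induction m)
  case 0
  have "0 \<in> W" using W_diff[OF W_one W_one] by simp
  then show ?case by simp
qed (auto intro: W_add W_const_mult W_X_power)

lemma character_sum_X:
  assumes \<xi>: "character \<xi>"
  shows "\<xi> (\<Sum>k<m. fps_const (c k) * fps_X ^ k) = (\<Sum>k<m. c k * \<xi> fps_X ^ k)"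
proof (induction m)
  case 0
  show ?case using characterD(3)[OF \<xi> W_one, of 0] by simp
next
  case (Suc m)
  have pow: "\<xi> (fps_X ^ k) = \<xi> fps_X ^ k" for k
    by (induction k) (simp_all add: characterD[OF \<xi>] W_X W_X_power)
  show ?case
    by (simp add: characterD(2,3)[OF \<xi>] W_sum_X W_X_power W_const_mult Suc pow)
qed

end

lemma (in renewal) polynomials_dense:
  assumes bd: "wbd \<alpha> M" and e: "0 < e"
  shows "\<exists>m. wbd (\<alpha> - (\<Sum>k<m. fps_const (fps_nth \<alpha> k) * fps_X ^ k)) e"
proof -
  define v where "v n = (cmod (fps_nth \<alpha> n))\<^sup>2 / a n" for n
  have v: "0 \<le> v n" for n using a_nonneg by (simp add: v_def)
  have "(\<Sum>i<n. v i) \<le> M\<^sup>2" for n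
  proof -
    have "(\<Sum>i<n. v i) \<le> (\<Sum>i\<le>n. v i)" using v by (intro sum_mono2) auto
    also have "\<dots> = (wnorm n \<alpha>)\<^sup>2" by (simp add: wnorm_sq v_def)
    also have "\<dots> \<le> M\<^sup>2" by (intro power_mono wbdD bd wnorm_nonneg)
    finally show ?thesis .
  qed
  then have sm: "summable v" using v by (rule summableI_nonneg_bounded[rotated])
  have "\<forall>\<^sub>F m in sequentially. dist (\<Sum>i<m. v i) (suminf v) < e\<^sup>2"
    using summable_LIMSEQ[OF sm] e by (intro tendstoD) auto
  then obtain m where m: "dist (\<Sum>i<m. v i) (suminf v) < e\<^sup>2"
    by (meson eventually_sequentially order_refl)
  let ?Q = "\<Sum>k<m. fps_const (fps_nth \<alpha> k) * fps_X ^ k"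
  have Q: "fps_nth ?Q n = (if n < m then fps_nth \<alpha> n else 0)" for n
    by (simp add: fps_sum_nth fps_X_power_nth if_distrib[of "\<lambda>x. _ * x"] cong: if_cong)
  have "(wnorm N (\<alpha> - ?Q))\<^sup>2 \<le> e\<^sup>2" for N
  proof -
    have "(wnorm N (\<alpha> - ?Q))\<^sup>2 = (\<Sum>n\<in>{m..N}. v n)"
      unfolding wnorm_sq fps_sub_nth Q by (rule sum.mono_neutral_cong_right) (auto simp: v_def)
    also have "\<dots> + (\<Sum>n<m. v n) = (\<Sum>n\<in>{m..N} \<union> {..<m}. v n)"
      by (rule sum.union_disjoint[symmetric]) auto
    also have "\<dots> \<le> suminf v" using sm v by (intro sum_le_suminf) auto
    finally show ?thesis using m by (simp add: dist_real_def)
  qed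
  then have "wbd (\<alpha> - ?Q) e"
    unfolding wbd_def using e by (auto intro: power2_le_imp_le less_imp_le)
  then show ?thesis by blast
qed

text \<open>  Uniform boundedness together with density: on polynomials the values of the characters are
  polynomials in their values at \<open>fps_X\<close>.\<close>

lemma (in renewal_algebra) characters_converge:
  assumes \<xi>: "\<And>i::nat. character (\<xi> i)" and X: "convergent (\<lambda>i. \<xi> i fps_X)" and \<alpha>: "\<alpha> \<in> W"
  shows "convergent (\<lambda>i. \<xi> i \<alpha>)"
proof -
  obtain M where M: "wbd \<alpha> M" using \<alpha> by (auto simp: W_def)
  have C: "0 < sqrt C" using C_ge_1 by simp
  have "Cauchy (\<lambda>i. \<xi> i \<alpha>)"
  proof (rule metric_CauchyI)
    fix e :: real assume e: "0 < e"
    then have "0 < e / (4 * sqrt C)" using C by simp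
    then obtain m where m: "wbd (\<alpha> - (\<Sum>k<m. fps_const (fps_nth \<alpha> k) * fps_X ^ k)) (e / (4 * sqrt C))"
      using polynomials_dense[OF M] by blast
    let ?Q = "\<Sum>k<m. fps_const (fps_nth \<alpha> k) * fps_X ^ k"
    have near: "dist (\<xi> i \<alpha>) (\<xi> i ?Q) \<le> e / 4" for i
    proof -
      have "\<xi> i \<alpha> = \<xi> i (\<alpha> - ?Q) + \<xi> i ?Q"
        using characterD(2)[OF \<xi> W_I[OF m] W_sum_X, of i "fps_nth \<alpha>" m] by simp
      then have "dist (\<xi> i \<alpha>) (\<xi> i ?Q) = cmod (\<xi> i (\<alpha> - ?Q))"
        by (simp add: dist_norm)
      also have "\<dots> \<le> sqrt C * (e / (4 * sqrt C))" by (rule character_bound[OF \<xi> m])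
      also have "\<dots> = e / 4" using C by simp
      finally show ?thesis .
    qed
    have "convergent (\<lambda>i. \<xi> i ?Q)"
    proof -
      obtain l where "(\<lambda>i. \<xi> i fps_X) \<longlonglongrightarrow> l" using X by (auto simp: convergent_def)
      then have "(\<lambda>i. \<Sum>k<m. fps_nth \<alpha> k * \<xi> i fps_X ^ k) \<longlonglongrightarrow> (\<Sum>k<m. fps_nth \<alpha> k * l ^ k)"
        by (intro tendsto_intros)
      then show ?thesis unfolding character_sum_X[OF \<xi>] convergent_def by blast
    qed
    then have "Cauchy (\<lambda>i. \<xi> i ?Q)" by (rule convergent_Cauchy)
    then obtain N where N: "\<And>i j. N \<le> i \<Longrightarrow> N \<le> j \<Longrightarrow> dist (\<xi> i ?Q) (\<xi> j ?Q) < e / 4"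
      using e metric_CauchyD[of "\<lambda>i. \<xi> i ?Q" "e / 4"] by auto
    have "dist (\<xi> i \<alpha>) (\<xi> j \<alpha>) < e" if "N \<le> i" "N \<le> j" for i j
    proof -
      have "dist (\<xi> i \<alpha>) (\<xi> j \<alpha>) \<le> dist (\<xi> i \<alpha>) (\<xi> i ?Q) + dist (\<xi> i ?Q) (\<xi> j \<alpha>)"
        by (rule dist_triangle)
      also have "dist (\<xi> i ?Q) (\<xi> j \<alpha>) \<le> dist (\<xi> i ?Q) (\<xi> j ?Q) + dist (\<xi> j ?Q) (\<xi> j \<alpha>)"
        by (rule dist_triangle)
      finally show ?thesis
        using near[of i] near[of j] N[OF that] e by (simp add: dist_commute)
    qed
    then show "\<exists>M. \<forall>i\<ge>M. \<forall>j\<ge>M. dist (\<xi> i \<alpha>) (\<xi> j \<alpha>) < e" by blast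
  qed
  then show ?thesis by (simp add: Cauchy_convergent_iff)
qed

section \<open>The model of the space cut out by an embedded disc\<close>

text \<open>  The set \<open>D\<close> of parameters is the open or the closed unit disc in the application. Its rotation
  symmetry is used to recover monomials from kernel functions.\<close>

locale embedded_disc =
  fixes H :: "((nat \<Rightarrow> complex) \<Rightarrow> complex) set"
    and ip :: "((nat \<Rightarrow> complex) \<Rightarrow> complex) \<Rightarrow> ((nat \<Rightarrow> complex) \<Rightarrow> complex) \<Rightarrow> complex"
    and b :: "nat \<Rightarrow> complex"
    and a :: "nat \<Rightarrow> real"
    and D :: "complex set"
  assumes da: "drury_arveson H ip"
    and b_1: "b 1 \<noteq> 0"
    and a_def: "Abs_fps a = inverse (1 - sq_fps b)"
    and D_ball: "z \<in> D \<Longrightarrow> disc_map b z \<in> l2_ball"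
    and D_rotation: "z \<in> D \<Longrightarrow> cmod w = cmod z \<Longrightarrow> w \<in> D"
    and D_nontrivial: "\<exists>z\<in>D. z \<noteq> 0"

sublocale embedded_disc \<subseteq> rkhs l2_ball da_kernel H ip
  using da by (simp add: drury_arveson_def)

sublocale embedded_disc \<subseteq> renewal "fps_nth (sq_fps b)" a
proof
  show "0 \<le> fps_nth (sq_fps b) n" for n by (simp add: sq_fps_def)
  show p0: "fps_nth (sq_fps b) 0 = 0" by (simp add: sq_fps_def)
  show "0 < fps_nth (sq_fps b) 1" using b_1 by (simp add: sq_fps_def)
  have "Abs_fps a * (1 - sq_fps b) = 1"
    unfolding a_def by (rule inverse_mult_eq_1) (simp add: p0)
  then have eq: "Abs_fps a = 1 + sq_fps b * Abs_fps a" by (simp add: algebra_simps)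
  have "a 0 = fps_nth (1 + sq_fps b * Abs_fps a) 0"
    unfolding eq[symmetric] by simp
  then show "a 0 = 1" by (simp add: p0)
  fix n :: nat assume n: "0 < n"
  have "a n = fps_nth (1 + sq_fps b * Abs_fps a) n"
    unfolding eq[symmetric] by simp
  then show "a n = (\<Sum>k\<le>n. fps_nth (sq_fps b) k * a (n - k))"
    using n by (simp add: fps_mult_nth atLeast0AtMost)
qed

context embedded_disc
begin

lemma norm_disc_map_sq: "(cmod (disc_map b z n))\<^sup>2 = fps_nth (sq_fps b) (Suc n) * ((cmod z)\<^sup>2) ^ Suc n"
  by (simp add: disc_map_def sq_fps_def norm_mult norm_power power_mult_distrib mult.commute flip: power_mult)

lemma summable_p: "z \<in> D \<Longrightarrow> summable (\<lambda>n. fps_nth (sq_fps b) n * ((cmod z)\<^sup>2) ^ n)"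
  using D_ball[of z] summable_iff_shift[of "\<lambda>n. fps_nth (sq_fps b) n * ((cmod z)\<^sup>2) ^ n" 1]
  unfolding l2_ball_def l2_def by (simp add: norm_disc_map_sq)

lemma suminf_p_lt_1:
  assumes "z \<in> D"
  shows "(\<Sum>n. fps_nth (sq_fps b) n * ((cmod z)\<^sup>2) ^ n) < 1"
proof -
  have "sqrt (\<Sum>n. (cmod (disc_map b z n))\<^sup>2) < 1"
    using D_ball[OF assms] by (simp add: l2_ball_def l2_norm_def)
  then have "(\<Sum>n. (cmod (disc_map b z n))\<^sup>2) < 1" by simp
  then show ?thesis
    using suminf_split_head[OF summable_p[OF assms]] by (simp add: norm_disc_map_sq p_0)
qed

lemma summable_a_D: "z \<in> D \<Longrightarrow> summable (\<lambda>n. a n * ((cmod z)\<^sup>2) ^ n)"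
  by (rule summable_a[OF _ summable_p suminf_p_lt_1]) auto

lemma abs_summable_D: "\<alpha> \<in> W \<Longrightarrow> z \<in> D \<Longrightarrow> abs_summable_at \<alpha> z"
  using wbd_eval(1)[OF _ summable_a_D] by (auto simp: W_def)

lemma D_mult_cnj:
  assumes "z \<in> D" "w \<in> D"
  obtains y where "y \<in> D" "cmod (z * cnj w) \<le> (cmod y)\<^sup>2"
proof (cases "cmod z \<le> cmod w")
  case True
  then show thesis
    using that[OF assms(2)] mult_right_mono[OF True norm_ge_zero[of w]]
    by (simp add: norm_mult power2_eq_square)
next
  case False
  then show thesis
    using that[OF assms(1)] mult_left_mono[of "cmod w" "cmod z" "cmod z"]
    by (simp add: norm_mult power2_eq_square)
qed

lemma da_kernel_disc_map:
  assumes "z \<in> D" "w \<in> D"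
  shows "(\<lambda>n. of_real (a n) * (z * cnj w) ^ n) sums da_kernel (disc_map b z) (disc_map b w)"
proof -
  obtain y where y: "y \<in> D" "cmod (z * cnj w) \<le> (cmod y)\<^sup>2"
    using D_mult_cnj[OF assms] .
  let ?t = "z * cnj w"
  have le: "c * cmod ?t ^ n \<le> c * ((cmod y)\<^sup>2) ^ n" if "0 \<le> c" for c n
    using that y by (intro mult_left_mono power_mono) auto
  have sm: "summable (\<lambda>n. fps_nth (sq_fps b) n * cmod ?t ^ n)"
    by (rule summable_comparison_test'[OF summable_p[OF y(1)]])
      (use le p_nonneg in simp)
  have "(\<Sum>n. fps_nth (sq_fps b) n * cmod ?t ^ n) \<le> (\<Sum>n. fps_nth (sq_fps b) n * ((cmod y)\<^sup>2) ^ n)"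
    by (intro suminf_le le sm summable_p y p_nonneg)
  then have lt: "(\<Sum>n. fps_nth (sq_fps b) n * cmod ?t ^ n) < 1"
    using suminf_p_lt_1[OF y(1)] by simp
  have coord: "disc_map b z n * cnj (disc_map b w n) = fps_nth s (Suc n) * ?t ^ Suc n" for n
  proof -
    have "fps_nth s (Suc n) = of_real ((cmod (b (Suc n)))\<^sup>2)"
      unfolding s_def by (simp add: sq_fps_def)
    also have "\<dots> = b (Suc n) * cnj (b (Suc n))" by (rule complex_norm_square)
    finally show ?thesis by (simp add: disc_map_def power_mult_distrib)
  qed
  have "summable (\<lambda>n. fps_nth s n * ?t ^ n)"
    using abs_summable_of_real[OF sm p_nonneg] unfolding s_def by (rule summable_norm_cancel)
  then have "l2_inner (disc_map b z) (disc_map b w) = eval_fps s ?t"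
    using suminf_split_head[of "\<lambda>n. fps_nth s n * ?t ^ n"]
    unfolding l2_inner_def coord eval_fps_def by (simp add: s_def p_0)
  then have "da_kernel (disc_map b z) (disc_map b w) = eval_fps a_fps ?t"
    unfolding da_kernel_def by (simp add: eval_a_fps[OF sm lt])
  moreover have "abs_summable_at a_fps ?t"
    unfolding a_fps_def using summable_a[OF _ sm lt] a_nonneg by (intro abs_summable_of_real) auto
  ultimately show ?thesis
    using summable_sums[OF summable_norm_cancel] by (fastforce simp: eval_fps_def a_fps_def)
qed

lemma inj_disc_map: "inj_on (disc_map b) D"
proof (rule inj_onI)
  fix z w assume "disc_map b z = disc_map b w"
  then have "disc_map b z 0 = disc_map b w 0" by simp
  then show "z = w" using b_1 by (simp add: disc_map_def)
qed

definition kern :: "complex \<Rightarrow> (nat \<Rightarrow> complex) \<Rightarrow> complex" where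
  "kern z = kernel_fun l2_ball da_kernel (disc_map b z)"

lemma kern_mem: "z \<in> D \<Longrightarrow> kern z \<in> H"
  unfolding kern_def by (intro kernel_mem D_ball)

lemma kern_apply: "z \<in> D \<Longrightarrow> w \<in> D \<Longrightarrow> kern z (disc_map b w) = da_kernel (disc_map b w) (disc_map b z)"
  by (simp add: kern_def kernel_fun_def restrict_zero_def D_ball)

lemma ip_kern: "h \<in> H \<Longrightarrow> z \<in> D \<Longrightarrow> ip h (kern z) = h (disc_map b z)"
  unfolding kern_def by (intro reproducing D_ball)

text \<open>  Pairs of a finite linear combination of kernel functions at points of the disc and of its power
  series in the parameter: by \<open>da_kernel_disc_map\<close>, the kernel function at the point with parameter
  \<open>z\<close> has the coefficients \<open>a n * cnj z ^ n\<close>.\<close>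

definition models :: "((nat \<Rightarrow> complex) \<Rightarrow> complex) \<Rightarrow> complex fps \<Rightarrow> bool" where
  "models g \<alpha> \<longleftrightarrow> (\<exists>F c. finite F \<and> F \<subseteq> D \<and> g = (\<lambda>x. \<Sum>z\<in>F. c z * kern z x) \<and>
     \<alpha> = Abs_fps (\<lambda>n. of_real (a n) * (\<Sum>z\<in>F. c z * cnj z ^ n)))"

lemma models_mem:
  assumes "models g \<alpha>"
  shows "g \<in> H"
proof -
  obtain F c where F: "finite F" "F \<subseteq> D" and g: "g = (\<lambda>x. \<Sum>z\<in>F. c z * kern z x)"
    using assms unfolding models_def by blast
  show ?thesis unfolding g by (rule sum_mem) (use F kern_mem in auto)
qed

lemma models_apply:
  assumes "models g \<alpha>" "w \<in> D"
  shows "(\<lambda>n. fps_nth \<alpha> n * w ^ n) sums g (disc_map b w)"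
proof -
  obtain F c where F: "finite F" "F \<subseteq> D" and g: "g = (\<lambda>x. \<Sum>z\<in>F. c z * kern z x)"
    and \<alpha>: "\<alpha> = Abs_fps (\<lambda>n. of_real (a n) * (\<Sum>z\<in>F. c z * cnj z ^ n))"
    using assms unfolding models_def by blast
  have "(\<lambda>n. \<Sum>z\<in>F. c z * (of_real (a n) * (w * cnj z) ^ n)) sums
      (\<Sum>z\<in>F. c z * da_kernel (disc_map b w) (disc_map b z))"
    using F assms(2) by (intro sums_sum sums_mult da_kernel_disc_map) auto
  moreover have "(\<Sum>z\<in>F. c z * da_kernel (disc_map b w) (disc_map b z)) = g (disc_map b w)"
    unfolding g using F assms(2) by (intro sum.cong refl) (auto simp: kern_apply)
  moreover have "(\<Sum>z\<in>F. c z * (of_real (a n) * (w * cnj z) ^ n)) = fps_nth \<alpha> n * w ^ n" for n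
    by (simp add: \<alpha> sum_distrib_left sum_distrib_right power_mult_distrib mult_ac)
  ultimately show ?thesis by simp
qed

text \<open>
  The correspondence is isometric, since both squared norms are the quadratic form
  \<open>\<Sum>z\<in>F. \<Sum>w\<in>F. c z * cnj (c w) * k w z\<close> of the kernel.
\<close>

lemma models_norm:
  assumes "models g \<alpha>"
  shows "(\<lambda>n. (cmod (fps_nth \<alpha> n))\<^sup>2 / a n) sums (ip_norm ip g)\<^sup>2"
proof -
  obtain F c where F: "finite F" "F \<subseteq> D" and g: "g = (\<lambda>x. \<Sum>z\<in>F. c z * kern z x)"
    and \<alpha>: "\<alpha> = Abs_fps (\<lambda>n. of_real (a n) * (\<Sum>z\<in>F. c z * cnj z ^ n))"
    using assms unfolding models_def by blast
  note gH = models_mem[OF assms]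
  have "ip g g = (\<Sum>z\<in>F. c z * ip (kern z) g)"
    using ip_sum[of F kern g c] F kern_mem gH unfolding g by blast
  also have "\<dots> = (\<Sum>z\<in>F. c z * cnj (g (disc_map b z)))"
  proof (rule sum.cong)
    fix z assume "z \<in> F"
    then have z: "z \<in> D" using F by blast
    then show "c z * ip (kern z) g = c z * cnj (g (disc_map b z))"
      using ip_cnj[OF gH kern_mem[OF z]] ip_kern[OF gH z] by simp
  qed simp
  finally have ip: "ip g g = (\<Sum>z\<in>F. c z * cnj (g (disc_map b z)))" .
  have "(\<lambda>n. \<Sum>z\<in>F. c z * cnj (fps_nth \<alpha> n * z ^ n)) sums ip g g"
    unfolding ip using F assms
    by (intro sums_sum sums_mult) (auto simp del: complex_cnj_mult intro!: sums_cnj[THEN iffD2] models_apply)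
  moreover have "(\<Sum>z\<in>F. c z * cnj (fps_nth \<alpha> n * z ^ n)) = of_real ((cmod (fps_nth \<alpha> n))\<^sup>2 / a n)" for n
  proof -
    have "(\<Sum>z\<in>F. c z * cnj (fps_nth \<alpha> n * z ^ n)) = cnj (fps_nth \<alpha> n) * (\<Sum>z\<in>F. c z * cnj z ^ n)"
      by (simp add: sum_distrib_left mult_ac)
    also have "(\<Sum>z\<in>F. c z * cnj z ^ n) = fps_nth \<alpha> n / of_real (a n)"
      using a_pos[of n] by (simp add: \<alpha>)
    finally show ?thesis by (simp add: complex_norm_square[symmetric] mult.commute)
  qed
  ultimately have "(\<lambda>n. complex_of_real ((cmod (fps_nth \<alpha> n))\<^sup>2 / a n)) sums of_real ((ip_norm ip g)\<^sup>2)"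
    by (simp only: ip_self[OF gH])
  then show ?thesis by (simp only: sums_of_real_iff)
qed

lemma models_wbd:
  assumes "models g \<alpha>"
  shows "wbd \<alpha> (ip_norm ip g)"
  unfolding wbd_def
proof
  fix N
  have "(wnorm N \<alpha>)\<^sup>2 \<le> (ip_norm ip g)\<^sup>2"
    unfolding wnorm_sq sums_unique[OF models_norm[OF assms]]
    using models_norm[OF assms] a_nonneg by (intro sum_le_suminf) (auto simp: sums_iff)
  then show "wnorm N \<alpha> \<le> ip_norm ip g"
    by (rule power2_le_imp_le) (rule ip_norm_nonneg[OF models_mem[OF assms]])
qed

lemma models_ip_norm_le:
  assumes "models g \<alpha>" "wbd \<alpha> M"
  shows "ip_norm ip g \<le> M"
proof (rule power2_le_imp_le)
  have "(\<Sum>n<N. (cmod (fps_nth \<alpha> n))\<^sup>2 / a n) \<le> M\<^sup>2" for N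
  proof -
    have "(\<Sum>n<N. (cmod (fps_nth \<alpha> n))\<^sup>2 / a n) \<le> (\<Sum>n\<le>N. (cmod (fps_nth \<alpha> n))\<^sup>2 / a n)"
      using a_nonneg by (intro sum_mono2) auto
    also have "\<dots> \<le> M\<^sup>2"
      unfolding wnorm_sq[symmetric] by (intro power_mono wbdD assms(2) wnorm_nonneg)
    finally show ?thesis .
  qed
  then show "(ip_norm ip g)\<^sup>2 \<le> M\<^sup>2"
    using models_norm[OF assms(1)] by (metis sums_unique sums_summable suminf_le_const)
qed (rule wbd_nonneg[OF assms(2)])

lemma models_lincomb:
  assumes "models g \<alpha>" "models h \<beta>"
  shows "models (\<lambda>x. g x + t * h x) (\<alpha> + fps_const t * \<beta>)"
proof -
  obtain F c where F: "finite F" "F \<subseteq> D" and g: "g = (\<lambda>x. \<Sum>z\<in>F. c z * kern z x)"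
    and \<alpha>: "\<alpha> = Abs_fps (\<lambda>n. of_real (a n) * (\<Sum>z\<in>F. c z * cnj z ^ n))"
    using assms(1) unfolding models_def by blast
  obtain E d where E: "finite E" "E \<subseteq> D" and h: "h = (\<lambda>x. \<Sum>z\<in>E. d z * kern z x)"
    and \<beta>: "\<beta> = Abs_fps (\<lambda>n. of_real (a n) * (\<Sum>z\<in>E. d z * cnj z ^ n))"
    using assms(2) unfolding models_def by blast
  define e where "e z = (if z \<in> F then c z else 0) + t * (if z \<in> E then d z else 0)" for z
  have sum_e: "(\<Sum>z\<in>F. c z * k z) + t * (\<Sum>z\<in>E. d z * k z) = (\<Sum>z\<in>F \<union> E. e z * k z)" for k
  proof -
    have "(\<Sum>z\<in>E. d z * k z) = (\<Sum>z\<in>F \<union> E. (if z \<in> E then d z else 0) * k z)"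
      using sum_extend_by_zero[OF E(1) F(1), of d k] by (simp only: Un_commute)
    then show ?thesis
      unfolding sum_extend_by_zero[OF F(1) E(1), of c k]
      by (simp only: e_def sum_distrib_left distrib_right sum.distrib mult.assoc)
  qed
  have "(\<lambda>x. g x + t * h x) = (\<lambda>x. \<Sum>z\<in>F \<union> E. e z * kern z x)"
    unfolding g h sum_e ..
  moreover have "\<alpha> + fps_const t * \<beta> = Abs_fps (\<lambda>n. of_real (a n) * (\<Sum>z\<in>F \<union> E. e z * cnj z ^ n))"
    by (rule fps_ext) (simp add: \<alpha> \<beta> sum_e[symmetric] algebra_simps)
  moreover have "finite (F \<union> E)" "F \<union> E \<subseteq> D" using F E by auto
  ultimately show ?thesis unfolding models_def by blast
qed

lemma models_diff:
  assumes "models g \<alpha>" "models h \<beta>"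
  shows "models (\<lambda>x. g x - h x) (\<alpha> - \<beta>)"
proof -
  have "\<alpha> + fps_const (-1) * \<beta> = \<alpha> - \<beta>" by (rule fps_ext) simp
  then show ?thesis using models_lincomb[OF assms, of "-1"] by simp
qed

lemma kernel_span_models: "g \<in> kernel_span l2_ball da_kernel (disc_map b ` D) \<longleftrightarrow> (\<exists>\<alpha>. models g \<alpha>)"
proof
  assume "g \<in> kernel_span l2_ball da_kernel (disc_map b ` D)"
  then obtain G c where G: "finite G" "G \<subseteq> disc_map b ` D"
    and g: "g = (\<lambda>x. \<Sum>y\<in>G. c y * kernel_fun l2_ball da_kernel y x)"
    unfolding kernel_span_def by blast
  then obtain F where F: "F \<subseteq> D" "finite F" "G = disc_map b ` F"
    using finite_subset_image[OF G] by blast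
  have "g = (\<lambda>x. \<Sum>z\<in>F. c (disc_map b z) * kern z x)"
    unfolding g F(3) kern_def by (subst sum.reindex) (auto intro: inj_on_subset[OF inj_disc_map F(1)])
  then show "\<exists>\<alpha>. models g \<alpha>"
    unfolding models_def using F by (intro exI[of _ "Abs_fps _"] exI[of _ F] exI[of _ "\<lambda>z. c (disc_map b z)"]) auto
next
  assume "\<exists>\<alpha>. models g \<alpha>"
  then obtain F c where F: "finite F" "F \<subseteq> D" and g: "g = (\<lambda>x. \<Sum>z\<in>F. c z * kern z x)"
    unfolding models_def by blast
  define d where "d y = c (inv_into D (disc_map b) y)" for y
  have "g = (\<lambda>x. \<Sum>y\<in>disc_map b ` F. d y * kernel_fun l2_ball da_kernel y x)"
  proof
    fix x
    have "(\<Sum>y\<in>disc_map b ` F. d y * kernel_fun l2_ball da_kernel y x)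
        = (\<Sum>z\<in>F. d (disc_map b z) * kern z x)"
      unfolding kern_def by (subst sum.reindex) (auto intro: inj_on_subset[OF inj_disc_map F(2)])
    also have "\<dots> = (\<Sum>z\<in>F. c z * kern z x)"
      using F(2) by (intro sum.cong refl) (auto simp: d_def inv_into_f_f[OF inj_disc_map])
    finally show "g x = (\<Sum>y\<in>disc_map b ` F. d y * kernel_fun l2_ball da_kernel y x)"
      by (simp add: g)
  qed
  then show "g \<in> kernel_span l2_ball da_kernel (disc_map b ` D)"
    unfolding kernel_span_def using F by blast
qed

end

text \<open>  Averaging over the rotations of \<open>w\<close> by \<open>N\<close>-th roots of unity against \<open>(z / w) ^ n / N\<close>
  annihilates all powers of \<open>cnj z\<close> with exponent below \<open>N\<close> except the \<open>n\<close>-th, and turns no power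
  into anything larger in modulus.\<close>

lemma roots_of_unity_sum:
  fixes N :: nat and w :: complex
  assumes "n < N" "w \<noteq> 0"
  defines "F \<equiv> (\<lambda>j. w * exp (2 * of_real pi * \<i> * of_nat j / of_nat N)) ` {..<N}"
  shows "finite F" "\<And>z. z \<in> F \<Longrightarrow> cmod z = cmod w"
    and "cmod (\<Sum>z\<in>F. (z / w) ^ n / of_nat N * cnj z ^ k) \<le> cmod w ^ k"
    and "k < N \<Longrightarrow> (\<Sum>z\<in>F. (z / w) ^ n / of_nat N * cnj z ^ k) = (if k = n then cnj w ^ n else 0)"
proof -
  define e where "e j = exp (2 * of_real pi * \<i> * of_nat j / of_nat N)" for j
  have N: "N \<noteq> 0" using assms by simp
  have norm_e: "cmod (e j) = 1" for j
    by (simp add: e_def norm_exp_eq_Re)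
  have e_pow: "e j ^ k = e (j * k)" for j k
    by (simp add: e_def mult_ac flip: exp_of_nat_mult)
  have e_eq: "e j = e k \<longleftrightarrow> j mod N = k mod N" for j k
    using complex_root_unity_eq[of N j k] N by (simp add: e_def)
  have F: "F = (\<lambda>j. w * e j) ` {..<N}" by (simp add: F_def e_def)
  show "finite F" by (simp add: F)
  show norm_F: "cmod z = cmod w" if "z \<in> F" for z
    using that by (auto simp: F norm_mult norm_e)
  have inj: "inj_on (\<lambda>j. w * e j) {..<N}"
    using assms(2) by (auto intro!: inj_onI simp: e_eq)
  then have card: "card F = N" by (simp add: F card_image)
  have "cmod (\<Sum>z\<in>F. (z / w) ^ n / of_nat N * cnj z ^ k) \<le> (\<Sum>z\<in>F. cmod w ^ k / of_nat N)"
    using assms(2) by (intro order_trans[OF norm_sum] sum_mono) (simp add: norm_mult norm_divide norm_power norm_F)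
  then show "cmod (\<Sum>z\<in>F. (z / w) ^ n / of_nat N * cnj z ^ k) \<le> cmod w ^ k"
    using N by (simp add: card)
  assume k: "k < N"
  define q where "q = e n / e k"
  have cnj_e: "cnj (e j) = 1 / e j" for j
  proof -
    have "e j \<noteq> 0" using norm_e[of j] by auto
    then show ?thesis
      using complex_norm_square[of "e j"] norm_e[of j] by (simp add: eq_divide_eq mult.commute)
  qed
  have "(\<Sum>z\<in>F. (z / w) ^ n / of_nat N * cnj z ^ k)
      = (\<Sum>j<N. (w * e j / w) ^ n / of_nat N * cnj (w * e j) ^ k)"
    unfolding F by (subst sum.reindex[OF inj]) simp
  also have "\<dots> = (\<Sum>j<N. cnj w ^ k / of_nat N * q ^ j)"
    using assms(2)
    by (intro sum.cong refl)
      (simp add: q_def cnj_e power_mult_distrib power_divide e_pow mult.commute)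
  also have "\<dots> = cnj w ^ k / of_nat N * (\<Sum>j<N. q ^ j)" by (simp add: sum_distrib_left)
  also have "\<dots> = (if k = n then cnj w ^ n else 0)"
  proof (cases "k = n")
    case True
    then show ?thesis using norm_e[of n] N by (auto simp: q_def)
  next
    case False
    then have "q \<noteq> 1" using e_eq[of n k] k assms(1) norm_e[of k] by (auto simp: q_def)
    moreover have "e (j * N) = 1" for j
      using e_eq[of "j * N" 0] by (simp add: e_def)
    then have "q ^ N = 1" by (simp add: q_def power_divide e_pow)
    ultimately show ?thesis using False by (simp add: sum_gp_strict)
  qed
  finally show "(\<Sum>z\<in>F. (z / w) ^ n / of_nat N * cnj z ^ k) = (if k = n then cnj w ^ n else 0)" .
qed

lemma eventually_inverse_Suc_less:
  fixes e :: real
  assumes "0 < e"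
  shows "\<exists>N. \<forall>j\<ge>N. 1 / real (Suc j) < e"
proof -
  obtain N where N: "1 / real (Suc N) < e" using assms by (rule nat_approx_posE)
  have "1 / real (Suc j) < e" if "N \<le> j" for j
    using that N by (intro le_less_trans[OF _ N] divide_left_mono) auto
  then show ?thesis by blast
qed

context embedded_disc
begin

definition approximable :: "complex fps \<Rightarrow> bool" where
  "approximable \<alpha> \<longleftrightarrow> (\<forall>e>0. \<exists>g \<beta>. models g \<beta> \<and> wbd (\<alpha> - \<beta>) e)"

lemma approximable_lincomb:
  assumes "approximable \<alpha>" "approximable \<beta>"
  shows "approximable (\<alpha> + fps_const t * \<beta>)"
  unfolding approximable_def
proof (intro allI impI)
  fix e :: real assume e: "0 < e"
  define d where "d = e / (1 + cmod t)"
  have t: "0 < 1 + cmod t" by (simp add: add_pos_nonneg)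
  have "d + cmod t * d = d * (1 + cmod t)" by (simp add: algebra_simps)
  then have d: "0 < d" "d + cmod t * d = e"
    using e t by (simp_all add: d_def)
  obtain g \<alpha>' where g: "models g \<alpha>'" "wbd (\<alpha> - \<alpha>') d" using assms(1) d(1) unfolding approximable_def by blast
  obtain h \<beta>' where h: "models h \<beta>'" "wbd (\<beta> - \<beta>') d" using assms(2) d(1) unfolding approximable_def by blast
  have "wbd ((\<alpha> - \<alpha>') + fps_const t * (\<beta> - \<beta>')) (d + cmod t * d)"
    by (intro wbd_add wbd_const_mult g h)
  then have "wbd ((\<alpha> + fps_const t * \<beta>) - (\<alpha>' + fps_const t * \<beta>')) e"
    unfolding d(2) by (simp add: algebra_simps)
  then show "\<exists>g \<beta>'. models g \<beta>' \<and> wbd (\<alpha> + fps_const t * \<beta> - \<beta>') e"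
    using models_lincomb[OF g(1) h(1)] by blast
qed

lemma approximable_0: "approximable 0"
proof -
  have "models (\<lambda>x. 0) 0"
    unfolding models_def by (intro exI[of _ "{}"]) (auto intro: fps_ext)
  moreover have "wbd (0 - 0) e" if "0 < e" for e
    using that wbd_const_mult[OF wbd_one, of 0] wbd_mono[of 0 0 e] by simp
  ultimately show ?thesis unfolding approximable_def by blast
qed

text \<open>  The average of kernel functions from \<open>roots_of_unity_sum\<close> has the \<open>n\<close>-th coefficient
  \<open>\<gamma> = a n * cnj w ^ n\<close>, no other coefficient below degree \<open>N\<close>, and beyond that at most those of the
  kernel function at \<open>w\<close>. The latter contribute a tail of the convergent series of squared norms.\<close>

lemma approximable_X_power: "approximable (fps_X ^ n)"
proof -
  obtain w where w: "w \<in> D" "w \<noteq> 0" using D_nontrivial by blast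
  define \<gamma> where "\<gamma> = of_real (a n) * cnj w ^ n"
  have "approximable (fps_const \<gamma> * fps_X ^ n)"
    unfolding approximable_def
  proof (intro allI impI)
    fix e :: real assume e: "0 < e"
    define v where "v k = a k * ((cmod w)\<^sup>2) ^ k" for k
    have v: "0 \<le> v k" for k using a_nonneg by (simp add: v_def)
    have sm: "summable v" unfolding v_def by (rule summable_a_D[OF w(1)])
    have "\<forall>\<^sub>F N in sequentially. dist (\<Sum>k<N. v k) (suminf v) < e\<^sup>2"
      using summable_LIMSEQ[OF sm] e by (intro tendstoD) auto
    then have "\<forall>\<^sub>F N in sequentially. dist (\<Sum>k<N. v k) (suminf v) < e\<^sup>2 \<and> n < N"
      using eventually_gt_at_top[of n] by (rule eventually_conj)
    then obtain N where N: "dist (\<Sum>k<N. v k) (suminf v) < e\<^sup>2" "n < N"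
      by (metis (no_types, lifting) eventually_sequentially order_refl)
    define F where "F = (\<lambda>j. w * exp (2 * of_real pi * \<i> * of_nat j / of_nat N)) ` {..<N}"
    note F = roots_of_unity_sum[OF N(2) w(2), folded F_def]
    define c where "c k = (\<Sum>z\<in>F. (z / w) ^ n / of_nat N * cnj z ^ k)" for k
    define \<beta> where "\<beta> = Abs_fps (\<lambda>k. of_real (a k) * c k)"
    have "models (\<lambda>x. \<Sum>z\<in>F. (z / w) ^ n / of_nat N * kern z x) \<beta>"
      unfolding models_def \<beta>_def c_def using F(1,2) D_rotation[OF w(1)]
      by (intro exI[of _ F] exI[of _ "\<lambda>z. (z / w) ^ n / of_nat N"]) auto
    moreover have "wnorm m (fps_const \<gamma> * fps_X ^ n - \<beta>) \<le> e" for m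
    proof (rule power2_le_imp_le)
      define \<delta> where "\<delta> = fps_const \<gamma> * fps_X ^ n - \<beta>"
      have low: "fps_nth \<delta> k = 0" if "k < N" for k
        using F(4)[OF that] by (simp add: \<delta>_def \<beta>_def c_def \<gamma>_def fps_X_power_nth)
      have high: "(cmod (fps_nth \<delta> k))\<^sup>2 / a k \<le> v k" if "N \<le> k" for k
      proof -
        have "cmod (fps_nth \<delta> k) = a k * cmod (c k)"
          using that N(2) a_nonneg[of k] by (simp add: \<delta>_def \<beta>_def fps_X_power_nth norm_mult)
        also have "\<dots> \<le> a k * cmod w ^ k"
          unfolding c_def using a_nonneg F(3) by (intro mult_left_mono)
        finally have "(cmod (fps_nth \<delta> k))\<^sup>2 \<le> (a k * cmod w ^ k)\<^sup>2"
          by (rule power_mono) simp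
        also have "\<dots> = a k * v k"
          by (simp add: v_def power2_eq_square power_mult_distrib)
        finally show ?thesis using a_pos[of k] by (simp add: divide_le_eq mult.commute)
      qed
      have "(wnorm m \<delta>)\<^sup>2 = (\<Sum>k\<in>{N..m}. (cmod (fps_nth \<delta> k))\<^sup>2 / a k)"
        unfolding wnorm_sq using low by (intro sum.mono_neutral_right) auto
      also have "\<dots> \<le> (\<Sum>k\<in>{N..m}. v k)"
        by (intro sum_mono high) auto
      also have "\<dots> + (\<Sum>k<N. v k) = (\<Sum>k\<in>{N..m} \<union> {..<N}. v k)"
        by (rule sum.union_disjoint[symmetric]) auto
      also have "\<dots> \<le> suminf v" using sm v by (intro sum_le_suminf) auto
      finally show "(wnorm m (fps_const \<gamma> * fps_X ^ n - \<beta>))\<^sup>2 \<le> e\<^sup>2"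
        unfolding \<delta>_def[symmetric] using N(1) by (simp add: dist_real_def)
    qed (use e in simp)
    ultimately show "\<exists>g \<beta>. models g \<beta> \<and> wbd (fps_const \<gamma> * fps_X ^ n - \<beta>) e"
      unfolding wbd_def by blast
  qed
  from approximable_lincomb[OF approximable_0 this, of "1 / \<gamma>"]
  have "approximable (fps_const (1 / \<gamma> * \<gamma>) * fps_X ^ n)"
    by (simp only: add_0 mult.assoc[symmetric] fps_const_mult)
  moreover have "\<gamma> \<noteq> 0" using w(2) a_pos[of n] by (simp add: \<gamma>_def)
  ultimately show ?thesis by simp
qed

lemma approximable_W:
  assumes "\<alpha> \<in> W"
  shows "approximable \<alpha>"
  unfolding approximable_def
proof (intro allI impI)
  fix e :: real assume e: "0 < e"
  obtain M where "wbd \<alpha> M" using assms by (auto simp: W_def)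
  then obtain m where m: "wbd (\<alpha> - (\<Sum>k<m. fps_const (fps_nth \<alpha> k) * fps_X ^ k)) (e / 2)"
    using polynomials_dense[of \<alpha> M "e / 2"] e by auto
  have "approximable (\<Sum>k<m. fps_const (c k) * fps_X ^ k)" for c
    by (induction m) (auto simp: approximable_0 approximable_X_power approximable_lincomb)
  then obtain g \<beta> where "models g \<beta>"
    and \<beta>: "wbd ((\<Sum>k<m. fps_const (fps_nth \<alpha> k) * fps_X ^ k) - \<beta>) (e / 2)"
    using e half_gt_zero unfolding approximable_def by blast
  then show "\<exists>g \<beta>. models g \<beta> \<and> wbd (\<alpha> - \<beta>) e"
    using wbd_triangle[OF m \<beta>] by auto
qed

text \<open>  The parameter of a point of the disc is its first coordinate divided by \<open>b 1\<close>.\<close>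

definition fun_of :: "complex fps \<Rightarrow> (nat \<Rightarrow> complex) \<Rightarrow> complex" where
  "fun_of \<alpha> = restrict_zero (disc_map b ` D) (\<lambda>x. eval_fps \<alpha> (x 0 / b 1))"

lemma fun_of_apply: "z \<in> D \<Longrightarrow> fun_of \<alpha> (disc_map b z) = eval_fps \<alpha> z"
  using b_1 by (simp add: fun_of_def restrict_zero_def disc_map_def)

lemma fun_of_outside: "x \<notin> disc_map b ` D \<Longrightarrow> fun_of \<alpha> x = 0"
  by (simp add: fun_of_def restrict_zero_def)

lemma fun_of_eqI:
  assumes "\<And>z. z \<in> D \<Longrightarrow> h (disc_map b z) = eval_fps \<alpha> z"
    and "\<And>x. x \<notin> disc_map b ` D \<Longrightarrow> h x = 0"
  shows "h = fun_of \<alpha>"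
proof
  fix x show "h x = fun_of \<alpha> x"
    using assms fun_of_apply fun_of_outside by (cases "x \<in> disc_map b ` D") auto
qed

text \<open>  Point evaluation is continuous for both norms, so a common limit of kernel combinations and of
  their power series is one and the same function on the disc.\<close>

lemma limit_of_models:
  assumes h: "h \<in> H"
    and lim: "\<And>e. 0 < e \<Longrightarrow> \<exists>g \<beta>. models g \<beta> \<and> ip_norm ip (\<lambda>x. h x - g x) \<le> e \<and> wbd (\<alpha> - \<beta>) e"
  shows "\<alpha> \<in> W" and "restrict_zero (disc_map b ` D) h = fun_of \<alpha>"
proof -
  show \<alpha>: "\<alpha> \<in> W"
  proof -
    obtain g \<beta> where "models g \<beta>" "wbd (\<alpha> - \<beta>) 1" using lim[of 1] by auto
    then have "\<alpha> - \<beta> + \<beta> \<in> W" by (intro W_add) (auto intro: W_I models_wbd)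
    then show ?thesis by simp
  qed
  have "h (disc_map b z) = eval_fps \<alpha> z" if z: "z \<in> D" for z
  proof -
    define K where "K = ip_norm ip (kern z) + sqrt (\<Sum>n. a n * ((cmod z)\<^sup>2) ^ n)"
    have "cmod (h (disc_map b z) - eval_fps \<alpha> z) \<le> e * K" if e: "0 < e" for e
    proof -
      obtain g \<beta> where g: "models g \<beta>" and hg: "ip_norm ip (\<lambda>x. h x - g x) \<le> e"
        and \<beta>: "wbd (\<alpha> - \<beta>) e"
        using lim[OF e] by blast
      note gH = models_mem[OF g]
      have "cmod (h (disc_map b z) - g (disc_map b z)) \<le> ip_norm ip (\<lambda>x. h x - g x) * ip_norm ip (kern z)"
        unfolding kern_def by (rule evaluation_bound[OF D_ball[OF z] diff_mem[OF h gH]])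
      also have "\<dots> \<le> e * ip_norm ip (kern z)"
        using hg ip_norm_nonneg[OF kern_mem[OF z]] by (rule mult_right_mono)
      finally have 1: "cmod (h (disc_map b z) - g (disc_map b z)) \<le> e * ip_norm ip (kern z)" .
      have "g (disc_map b z) = eval_fps \<beta> z"
        unfolding eval_fps_def using models_apply[OF g z] by (rule sums_unique)
      then have "g (disc_map b z) - eval_fps \<alpha> z = - eval_fps (\<alpha> - \<beta>) z"
        using eval_fps_diff_abs[OF abs_summable_D[OF \<alpha> z] abs_summable_D[OF W_I[OF models_wbd[OF g]] z]]
        by simp
      then have 2: "cmod (g (disc_map b z) - eval_fps \<alpha> z) \<le> e * sqrt (\<Sum>n. a n * ((cmod z)\<^sup>2) ^ n)"
        using wbd_eval(2)[OF \<beta> summable_a_D[OF z]] by simp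
      show ?thesis
        using norm_triangle_ineq[of "h (disc_map b z) - g (disc_map b z)" "g (disc_map b z) - eval_fps \<alpha> z"] 1 2
        by (simp add: K_def distrib_left)
    qed
    note bound = this
    have "K \<ge> 0"
      unfolding K_def using ip_norm_nonneg[OF kern_mem[OF z]] summable_a_D[OF z] a_nonneg
      by (simp add: suminf_nonneg)
    have "cmod (h (disc_map b z) - eval_fps \<alpha> z) \<le> 0 + e" if "0 < e" for e
    proof -
      have "cmod (h (disc_map b z) - eval_fps \<alpha> z) \<le> e / (K + 1) * K"
        using \<open>K \<ge> 0\<close> that by (intro bound) simp
      also have "\<dots> \<le> e" using \<open>K \<ge> 0\<close> that by (simp add: field_simps)
      finally show ?thesis by simp
    qed
    then have "cmod (h (disc_map b z) - eval_fps \<alpha> z) \<le> 0" by (rule field_le_epsilon)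
    then show ?thesis by simp
  qed
  then show "restrict_zero (disc_map b ` D) h = fun_of \<alpha>"
    by (intro fun_of_eqI) (auto simp: restrict_zero_def)
qed

text \<open>  The isometry between kernel combinations and power series extends to the closures. The image is
  all of \<open>W\<close> because power series of kernel combinations are dense there (\<open>approximable_W\<close>). The
  completeness of \<open>W\<close> gives one inclusion, that of \<open>H\<close> the other.\<close>

lemma subspace_on_eq: "subspace_on l2_ball da_kernel H ip (disc_map b ` D) = fun_of ` W"
proof (intro equalityI subsetI)
  fix f assume "f \<in> subspace_on l2_ball da_kernel H ip (disc_map b ` D)"
  then obtain h where f: "f = restrict_zero (disc_map b ` D) h" and h: "h \<in> H"
    and app: "\<And>e. 0 < e \<Longrightarrow> \<exists>g\<in>kernel_span l2_ball da_kernel (disc_map b ` D). ip_norm ip (\<lambda>x. h x - g x) < e"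
    unfolding subspace_on_def closure_in_def by blast
  have "\<exists>g \<beta>. models g \<beta> \<and> ip_norm ip (\<lambda>x. h x - g x) < 1 / Suc j" for j
    using app[of "1 / Suc j"] kernel_span_models by auto
  then obtain g \<beta> where g: "\<And>j. models (g j) (\<beta> j)" "\<And>j. ip_norm ip (\<lambda>x. h x - g j x) < 1 / Suc j"
    by metis
  note small = eventually_inverse_Suc_less
  have "\<exists>N. \<forall>i\<ge>N. \<forall>j\<ge>N. wbd (\<beta> i - \<beta> j) e" if e: "0 < e" for e
  proof -
    obtain N where N: "\<And>j. N \<le> j \<Longrightarrow> 1 / real (Suc j) < e / 2" using small[of "e / 2"] e by auto
    have "wbd (\<beta> i - \<beta> j) e" if "N \<le> i" "N \<le> j" for i j
    proof (rule wbd_mono)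
      show "wbd (\<beta> i - \<beta> j) (ip_norm ip (\<lambda>x. g i x - g j x))"
        by (intro models_wbd models_diff g)
      have "ip_norm ip (\<lambda>x. g i x - g j x) \<le> ip_norm ip (\<lambda>x. g i x - h x) + ip_norm ip (\<lambda>x. h x - g j x)"
        by (intro ip_norm_triangle models_mem[OF g(1)] h)
      also have "ip_norm ip (\<lambda>x. g i x - h x) = ip_norm ip (\<lambda>x. h x - g i x)"
        by (intro ip_norm_minus_commute models_mem[OF g(1)] h)
      finally show "ip_norm ip (\<lambda>x. g i x - g j x) \<le> e"
        using g(2)[of i] g(2)[of j] N[OF that(1)] N[OF that(2)] by linarith
    qed
    then show ?thesis by blast
  qed
  then obtain \<alpha> where \<alpha>: "\<And>e. 0 < e \<Longrightarrow> \<exists>N. \<forall>i\<ge>N. wbd (\<alpha> - \<beta> i) e"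
    using W_complete[of \<beta>] by blast
  have "\<exists>g \<beta>. models g \<beta> \<and> ip_norm ip (\<lambda>x. h x - g x) \<le> e \<and> wbd (\<alpha> - \<beta>) e" if e: "0 < e" for e
  proof -
    obtain N1 where N1: "\<forall>i\<ge>N1. wbd (\<alpha> - \<beta> i) e" using \<alpha>[OF e] by blast
    obtain N2 where N2: "\<forall>j\<ge>N2. 1 / real (Suc j) < e" using small[OF e] by blast
    have "ip_norm ip (\<lambda>x. h x - g (max N1 N2) x) \<le> e"
      using N2 g(2)[of "max N1 N2"] by (smt (verit) max.cobounded2)
    then show ?thesis using g(1) N1 by (meson max.cobounded1)
  qed
  from limit_of_models[OF h this] show "f \<in> fun_of ` W"
    unfolding f by blast
next
  fix f assume "f \<in> fun_of ` W"
  then obtain \<alpha> where \<alpha>: "\<alpha> \<in> W" "f = fun_of \<alpha>" by blast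
  have "\<exists>g \<beta>. models g \<beta> \<and> wbd (\<alpha> - \<beta>) (1 / Suc j)" for j
    using approximable_W[OF \<alpha>(1)] unfolding approximable_def by simp
  then obtain g \<beta> where g: "\<And>j. models (g j) (\<beta> j)" "\<And>j. wbd (\<alpha> - \<beta> j) (1 / Suc j)"
    by metis
  note small = eventually_inverse_Suc_less
  have cauchy: "\<forall>e>0. \<exists>N. \<forall>i\<ge>N. \<forall>j\<ge>N. ip_norm ip (\<lambda>x. g i x - g j x) < e"
  proof (intro allI impI)
    fix e :: real assume e: "0 < e"
    obtain N where N: "\<And>j. N \<le> j \<Longrightarrow> 1 / real (Suc j) < e / 2" using small[of "e / 2"] e by auto
    have "ip_norm ip (\<lambda>x. g i x - g j x) < e" if "N \<le> i" "N \<le> j" for i j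
    proof -
      have "wbd (\<beta> i - \<beta> j) (1 / Suc i + 1 / Suc j)"
        by (rule wbd_triangle[OF g(2)[of i, unfolded wbd_minus_commute[of \<alpha>]] g(2)])
      then have "ip_norm ip (\<lambda>x. g i x - g j x) \<le> 1 / Suc i + 1 / Suc j"
        by (rule models_ip_norm_le[OF models_diff[OF g(1) g(1)]])
      then show ?thesis using N[OF that(1)] N[OF that(2)] by linarith
    qed
    then show "\<exists>N. \<forall>i\<ge>N. \<forall>j\<ge>N. ip_norm ip (\<lambda>x. g i x - g j x) < e" by blast
  qed
  obtain h where h: "h \<in> H" and lim: "(\<lambda>n. ip_norm ip (\<lambda>x. g n x - h x)) \<longlonglongrightarrow> 0"
    using complete[OF models_mem[OF g(1)] cauchy] by blast
  have close: "\<exists>j. ip_norm ip (\<lambda>x. h x - g j x) < e \<and> 1 / real (Suc j) < e" if e: "0 < e" for e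
  proof -
    obtain N where N: "\<forall>j\<ge>N. 1 / real (Suc j) < e" using small[OF e] by blast
    obtain N' where N': "\<forall>j\<ge>N'. ip_norm ip (\<lambda>x. g j x - h x) < e"
      using order_tendstoD(2)[OF lim e] unfolding eventually_sequentially by blast
    have "ip_norm ip (\<lambda>x. h x - g (max N N') x) < e"
      using N' ip_norm_minus_commute[OF h models_mem[OF g(1)]] by simp
    then show ?thesis using N by (intro exI[of _ "max N N'"]) simp
  qed
  have "h \<in> closure_in H ip (kernel_span l2_ball da_kernel (disc_map b ` D))"
    unfolding closure_in_def using h close kernel_span_models g(1) by blast
  moreover have "restrict_zero (disc_map b ` D) h = fun_of \<alpha>"
  proof (rule limit_of_models(2)[OF h])
    fix e :: real assume "0 < e"
    then obtain j where j: "ip_norm ip (\<lambda>x. h x - g j x) < e" "1 / real (Suc j) < e"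
      using close by blast
    then show "\<exists>g \<beta>. models g \<beta> \<and> ip_norm ip (\<lambda>x. h x - g x) \<le> e \<and> wbd (\<alpha> - \<beta>) e"
      using g(1)[of j] wbd_mono[OF g(2)[of j]] by (meson less_imp_le)
  qed
  ultimately show "f \<in> subspace_on l2_ball da_kernel H ip (disc_map b ` D)"
    unfolding subspace_on_def \<alpha>(2) by (metis imageI)
qed

lemma fun_of_add: "\<alpha> \<in> W \<Longrightarrow> \<beta> \<in> W \<Longrightarrow> fun_of (\<alpha> + \<beta>) = (\<lambda>x. fun_of \<alpha> x + fun_of \<beta> x)"
  by (rule sym, rule fun_of_eqI)
    (auto simp: fun_of_apply fun_of_outside eval_fps_add_abs abs_summable_D)

lemma fun_of_const_mult: "\<alpha> \<in> W \<Longrightarrow> fun_of (fps_const c * \<alpha>) = (\<lambda>x. c * fun_of \<alpha> x)"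
  by (rule sym, rule fun_of_eqI)
    (auto simp: fun_of_apply fun_of_outside eval_fps_const_mult_abs abs_summable_D)

lemma fun_of_mult: "\<alpha> \<in> W \<Longrightarrow> \<beta> \<in> W \<Longrightarrow> fun_of (\<alpha> * \<beta>) = (\<lambda>x. fun_of \<alpha> x * fun_of \<beta> x)"
  by (rule sym, rule fun_of_eqI)
    (auto simp: fun_of_apply fun_of_outside eval_fps_mult_abs abs_summable_D)

lemma fun_of_one: "fun_of 1 = indicator (disc_map b ` D)"
  by (rule sym, rule fun_of_eqI) (auto simp: indicator_def)

text \<open>  The constant function \<open>1\<close> lies in the space, so a multiplier \<open>\<phi> = \<phi> * 1\<close> does, too.\<close>

lemma mult_alg_subset: "mult_alg H ip (disc_map b ` D) \<subseteq> fun_of ` W"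
proof
  fix \<phi> assume \<phi>: "\<phi> \<in> mult_alg H ip (disc_map b ` D)"
  then have "(\<lambda>x. \<phi> x * fun_of 1 x) \<in> fun_of ` W"
    unfolding mult_alg_def multipliers_def subspace_on_eq using W_one by blast
  moreover have "\<phi> x * fun_of 1 x = \<phi> x" for x
    using \<phi> unfolding mult_alg_def multipliers_def fun_of_one
    by (cases "x \<in> disc_map b ` D") (auto simp: indicator_def)
  ultimately show "\<phi> \<in> fun_of ` W" by simp
qed

lemma fun_of_mult_alg:
  assumes "\<phi> \<in> W" "\<And>\<alpha>. \<alpha> \<in> W \<Longrightarrow> \<phi> * \<alpha> \<in> W"
  shows "fun_of \<phi> \<in> mult_alg H ip (disc_map b ` D)"
  unfolding mult_alg_def multipliers_def subspace_on_eq
  using assms by (auto simp: fun_of_outside fun_of_mult[symmetric])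

end

section \<open>Convergent characters and divergent multipliers\<close>

definition algebra_character ::
  "('a \<Rightarrow> complex) set \<Rightarrow> 'a set \<Rightarrow> (('a \<Rightarrow> complex) \<Rightarrow> complex) \<Rightarrow> bool" where
  "algebra_character A X \<xi> \<longleftrightarrow> \<xi> (indicator X) = 1 \<and>
     (\<forall>\<phi>\<in>A. \<forall>\<psi>\<in>A. \<xi> (\<lambda>x. \<phi> x + \<psi> x) = \<xi> \<phi> + \<xi> \<psi>) \<and>
     (\<forall>\<phi>\<in>A. \<forall>c. \<xi> (\<lambda>x. c * \<phi> x) = c * \<xi> \<phi>) \<and>
     (\<forall>\<phi>\<in>A. \<forall>\<psi>\<in>A. \<xi> (\<lambda>x. \<phi> x * \<psi> x) = \<xi> \<phi> * \<xi> \<psi>)"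

locale embedded_disc_algebra = embedded_disc + renewal_algebra "fps_nth (sq_fps b)" a C for C
begin

lemma mult_alg_eq: "mult_alg H ip (disc_map b ` D) = fun_of ` W"
  using mult_alg_subset fun_of_mult_alg W_mult by blast

text \<open>  The values at the coordinate function are bounded, and a subsequence along which they converge
  is good for all multipliers by \<open>characters_converge\<close>.\<close>

lemma characters_subconverge:
  assumes \<xi>: "\<And>i::nat. algebra_character (mult_alg H ip (disc_map b ` D)) (disc_map b ` D) (\<xi> i)"
  obtains \<sigma> :: "nat \<Rightarrow> nat" where "strict_mono \<sigma>"
    "\<And>\<phi>. \<phi> \<in> mult_alg H ip (disc_map b ` D) \<Longrightarrow> convergent (\<lambda>i. \<xi> (\<sigma> i) \<phi>)"
proof -
  have char: "character (\<lambda>\<alpha>. \<xi> i (fun_of \<alpha>))" for i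
    using \<xi>[of i] unfolding character_def algebra_character_def mult_alg_eq
    by (simp add: fun_of_one fun_of_add fun_of_const_mult fun_of_mult)
  obtain M where M: "wbd fps_X M" using W_X by (auto simp: W_def)
  have "bounded (range (\<lambda>i. \<xi> i (fun_of fps_X)))"
    using character_bound[OF char M] by (intro boundedI[of _ "sqrt C * M"]) auto
  then obtain l \<sigma> where \<sigma>: "strict_mono \<sigma>" "((\<lambda>i. \<xi> i (fun_of fps_X)) \<circ> \<sigma>) \<longlonglongrightarrow> l"
    using bounded_imp_convergent_subsequence by blast
  then have "convergent (\<lambda>i. \<xi> (\<sigma> i) (fun_of fps_X))"
    by (auto simp: convergent_def o_def)
  then have "convergent (\<lambda>i. \<xi> (\<sigma> i) (fun_of \<alpha>))" if "\<alpha> \<in> W" for \<alpha>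
    using characters_converge[of "\<lambda>i \<alpha>. \<xi> (\<sigma> i) (fun_of \<alpha>)", OF char _ that] by simp
  then show thesis
    using that[OF \<sigma>(1)] unfolding mult_alg_eq by blast
qed

end

lemma fast_subsequence:
  fixes v :: "nat \<Rightarrow> real"
  assumes "v \<longlonglongrightarrow> 1" "\<And>k. v k < 1"
  obtains \<tau> :: "nat \<Rightarrow> nat" where "strict_mono \<tau>"
    "\<And>k. 1 - v (\<tau> (Suc k)) \<le> (1 - v (\<tau> k)) / 2 ^ (k + 4)"
proof -
  \<comment> \<open>The conjunct \<open>True\<close> fits the statement to \<open>dependent_nat_choice\<close>, which carries an invariant.\<close>
  have "\<exists>\<tau>. \<forall>k. True \<and> (\<tau> k < \<tau> (Suc k) \<and> 1 - v (\<tau> (Suc k)) \<le> (1 - v (\<tau> k)) / 2 ^ (k + 4))"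
  proof (rule dependent_nat_choice)
    fix m k :: nat
    have "1 - (1 - v m) / 2 ^ (k + 4) < 1" using assms(2)[of m] by simp
    then have "\<forall>\<^sub>F l in sequentially. 1 - (1 - v m) / 2 ^ (k + 4) < v l"
      using assms(1) by (rule order_tendstoD(1)[rotated])
    then have "\<forall>\<^sub>F l in sequentially. 1 - (1 - v m) / 2 ^ (k + 4) < v l \<and> m < l"
      using eventually_gt_at_top[of m] by (rule eventually_conj)
    then obtain l where l: "1 - (1 - v m) / 2 ^ (k + 4) < v l" "m < l"
      by (metis (no_types, lifting) eventually_sequentially order_refl)
    from l(1) have "1 - v l \<le> (1 - v m) / 2 ^ (k + 4)" by linarith
    with l(2) show "\<exists>l. True \<and> (m < l \<and> 1 - v l \<le> (1 - v m) / 2 ^ (k + 4))" by blast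
  qed simp
  then obtain \<tau> where "\<And>k. \<tau> k < \<tau> (Suc k)" "\<And>k. 1 - v (\<tau> (Suc k)) \<le> (1 - v (\<tau> k)) / 2 ^ (k + 4)"
    by blast
  then show thesis using that by (auto simp: strict_mono_Suc_iff)
qed

text \<open>  Along a fast subsequence the multiplier from \<open>contractive_oscillating\<close> is \<open>0\<close> at the odd and at
  least \<open>1 / 2\<close> in modulus at the even terms.\<close>

lemma (in embedded_disc) divergent_multiplier:
  assumes p: "\<And>N. (\<Sum>n\<le>N. fps_nth (sq_fps b) n) \<le> 1"
    and z: "\<And>k. z k \<in> D" "\<And>k. cmod (z k) < 1" "\<And>k. eval_fps s (z k) = of_real (v k)"
    and v: "v \<longlonglongrightarrow> 1" "\<And>k. 0 \<le> v k" "\<And>k. v k < 1"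
  obtains \<phi> where "\<phi> \<in> mult_alg H ip (disc_map b ` D)" "\<not> convergent (\<lambda>k. \<phi> (disc_map b (z k)))"
proof -
  obtain \<tau> where \<tau>: "strict_mono \<tau>" "\<And>k. 1 - v (\<tau> (Suc k)) \<le> (1 - v (\<tau> k)) / 2 ^ (k + 4)"
    using fast_subsequence[OF v(1,3)] by blast
  obtain \<phi> where \<phi>: "contractive \<phi>"
    "\<And>y j. cmod y < 1 \<Longrightarrow> eval_fps s y = of_real (v (\<tau> (2 * j + 1))) \<Longrightarrow> eval_fps \<phi> y = 0"
    "\<And>y j. cmod y < 1 \<Longrightarrow> eval_fps s y = of_real (v (\<tau> (2 * j))) \<Longrightarrow> 1 / 2 \<le> cmod (eval_fps \<phi> y)"
    using contractive_oscillating[of "\<lambda>k. v (\<tau> k)", OF p v(2,3) \<tau>(2)] by metis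
  have "\<not> convergent (\<lambda>k. fun_of \<phi> (disc_map b (z k)))"
  proof
    assume "convergent (\<lambda>k. fun_of \<phi> (disc_map b (z k)))"
    then obtain l where "(\<lambda>k. eval_fps \<phi> (z k)) \<longlonglongrightarrow> l"
      by (auto simp: convergent_def fun_of_apply z)
    then have "((\<lambda>k. eval_fps \<phi> (z k)) \<circ> \<tau>) \<longlonglongrightarrow> l"
      using \<tau>(1) by (rule LIMSEQ_subseq_LIMSEQ)
    then have lim: "(\<lambda>k. eval_fps \<phi> (z (\<tau> k))) \<longlonglongrightarrow> l" by (simp add: o_def)
    have "strict_mono (\<lambda>j::nat. 2 * j + 1)" "strict_mono (\<lambda>j::nat. 2 * j)"
      by (simp_all add: strict_mono_def)
    from LIMSEQ_subseq_LIMSEQ[OF lim this(1)] LIMSEQ_subseq_LIMSEQ[OF lim this(2)]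
    have odd: "(\<lambda>j. eval_fps \<phi> (z (\<tau> (2 * j + 1)))) \<longlonglongrightarrow> l"
      and even: "(\<lambda>j. eval_fps \<phi> (z (\<tau> (2 * j)))) \<longlonglongrightarrow> l"
      by (simp_all add: o_def)
    have "l = 0"
      using odd \<phi>(2)[OF z(2) z(3)] by (simp add: LIMSEQ_const_iff)
    moreover have "1 / 2 \<le> cmod l"
      using tendsto_norm[OF even] \<phi>(3)[OF z(2) z(3)]
      by (intro tendsto_lowerbound[where F = sequentially]) auto
    ultimately show False by simp
  qed
  then show thesis
    using that[of "fun_of \<phi>"] fun_of_mult_alg[of \<phi>] contractive_W[OF \<phi>(1)]
      W_I[OF contractive_wbd_one[OF \<phi>(1)]] by blast
qed

section \<open>The two discs\<close>

lemma l2_sq_fps_sums: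
  assumes "coeff_vec b \<in> l2"
  shows "fps_nth (sq_fps b) sums (l2_norm (coeff_vec b))\<^sup>2"
proof -
  have eq: "(cmod (coeff_vec b n))\<^sup>2 = fps_nth (sq_fps b) (Suc n)" for n
    by (simp add: coeff_vec_def sq_fps_def)
  have sm: "summable (\<lambda>n. fps_nth (sq_fps b) (Suc n))"
    using assms by (simp add: l2_def eq)
  then have "(l2_norm (coeff_vec b))\<^sup>2 = (\<Sum>n. fps_nth (sq_fps b) (Suc n))"
    unfolding l2_norm_def eq by (simp add: suminf_nonneg sq_fps_def)
  moreover have "fps_nth (sq_fps b) 0 = 0" by (simp add: sq_fps_def)
  ultimately show ?thesis
    using sums_Suc[OF summable_sums[OF sm]] by simp
qed

lemma sq_fps_nonneg: "0 \<le> fps_nth (sq_fps b) n"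
  by (simp add: sq_fps_def)

text \<open>All coordinates of \<open>disc_map b z\<close> are divisible by \<open>z\<close>, hence the factor \<open>cmod z\<close>.\<close>

lemma disc_map_in_l2:
  assumes b: "coeff_vec b \<in> l2" and z: "cmod z \<le> 1"
  shows "disc_map b z \<in> l2" "l2_norm (disc_map b z) \<le> cmod z * l2_norm (coeff_vec b)"
proof -
  have le: "(cmod (disc_map b z n))\<^sup>2 \<le> (cmod z)\<^sup>2 * (cmod (coeff_vec b n))\<^sup>2" for n
  proof -
    have "cmod z ^ Suc n \<le> cmod z ^ 1" using z by (intro power_decreasing) auto
    then have "cmod (disc_map b z n) \<le> cmod z * cmod (coeff_vec b n)"
      using mult_left_mono[of "cmod z ^ Suc n" "cmod z" "cmod (b (Suc n))"]
      by (simp add: disc_map_def coeff_vec_def norm_mult norm_power mult.commute)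
    then have "(cmod (disc_map b z n))\<^sup>2 \<le> (cmod z * cmod (coeff_vec b n))\<^sup>2" by (rule power_mono) simp
    then show ?thesis by (simp add: power_mult_distrib)
  qed
  have sm: "summable (\<lambda>n. (cmod (coeff_vec b n))\<^sup>2)" using b by (simp add: l2_def)
  then have sm': "summable (\<lambda>n. (cmod z)\<^sup>2 * (cmod (coeff_vec b n))\<^sup>2)" by (rule summable_mult)
  have sd: "summable (\<lambda>n. (cmod (disc_map b z n))\<^sup>2)"
    by (rule summable_comparison_test'[OF sm']) (use le in simp)
  then show "disc_map b z \<in> l2" by (simp add: l2_def)
  have "(\<Sum>n. (cmod (disc_map b z n))\<^sup>2) \<le> (\<Sum>n. (cmod z)\<^sup>2 * (cmod (coeff_vec b n))\<^sup>2)"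
    by (rule suminf_le[OF le sd sm'])
  also have "\<dots> = (cmod z)\<^sup>2 * (\<Sum>n. (cmod (coeff_vec b n))\<^sup>2)" by (rule suminf_mult[OF sm])
  finally have "sqrt (\<Sum>n. (cmod (disc_map b z n))\<^sup>2) \<le> sqrt \<dots>" by (rule real_sqrt_le_mono)
  then show "l2_norm (disc_map b z) \<le> cmod z * l2_norm (coeff_vec b)"
    by (simp add: l2_norm_def real_sqrt_mult)
qed

text \<open>  Abel's theorem for the nonnegative coefficients \<open>(cmod (b n))\<^sup>2\<close> with sum \<open>1\<close>, along one sequence of
  radii. The values are below \<open>1\<close> because the constant term is missing.\<close>

lemma sq_fps_radial_limit:
  assumes b: "coeff_vec b \<in> l2" "l2_norm (coeff_vec b) = 1"
  defines "r k \<equiv> 1 - 1 / (real k + 2)"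
  defines "v k \<equiv> (\<Sum>n. fps_nth (sq_fps b) n * r k ^ n)"
  shows "v \<longlonglongrightarrow> 1" and "0 \<le> v k" and "v k < 1"
    and "(\<lambda>n. fps_nth (sq_fps b) n * r k ^ n) sums v k"
proof -
  let ?p = "fps_nth (sq_fps b)"
  have p: "?p sums 1" using l2_sq_fps_sums[OF b(1)] b(2) by simp
  have r: "0 \<le> r k" "r k < 1" for k by (simp_all add: r_def divide_le_eq)
  have le: "?p n * r k ^ n \<le> ?p n" for n k
    using r[of k] sq_fps_nonneg[of b n] by (simp add: mult_left_le power_le_one)
  have sm: "summable (\<lambda>n. ?p n * r k ^ n)" for k
    by (rule summable_comparison_test'[OF sums_summable[OF p]])
      (use le r sq_fps_nonneg in \<open>simp add: abs_mult\<close>)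
  then show "(\<lambda>n. ?p n * r k ^ n) sums v k" unfolding v_def by (rule summable_sums)
  show "0 \<le> v k"
    unfolding v_def using r sq_fps_nonneg by (intro suminf_nonneg sm) simp
  have "v k \<le> (\<Sum>n. ?p n * r k)"
    unfolding v_def
  proof (rule suminf_le[OF _ sm])
    fix n
    show "?p n * r k ^ n \<le> ?p n * r k"
    proof (cases n)
      case 0
      then show ?thesis by (simp add: sq_fps_def)
    next
      case (Suc m)
      then have "r k ^ n \<le> r k" using r[of k] by (simp add: mult_left_le power_le_one)
      then show ?thesis using sq_fps_nonneg by (rule mult_left_mono)
    qed
  qed (rule summable_mult2[OF sums_summable[OF p]])
  also have "\<dots> = r k" using sums_unique[OF sums_mult2[OF p, of "r k"]] by simp
  finally show "v k < 1" using r(2)[of k] by simp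
  have "r \<longlonglongrightarrow> 1"
    unfolding r_def by real_asymp
  then have "(\<lambda>k. ?p n * r k ^ n) \<longlonglongrightarrow> ?p n * 1 ^ n" for n
    by (intro tendsto_intros)
  then have "((\<lambda>k. \<Sum>n. ?p n * r k ^ n) \<longlongrightarrow> (\<Sum>n. ?p n * 1 ^ n)) sequentially"
    using le r sq_fps_nonneg sums_summable[OF p]
    by (intro conjunct2[OF conjunct2[OF tannerys_theorem[where M = ?p]]])
      (auto intro!: always_eventually simp: abs_mult)
  moreover have "v = (\<lambda>k. \<Sum>n. ?p n * r k ^ n)" by (simp add: v_def fun_eq_iff)
  ultimately show "v \<longlonglongrightarrow> 1" using sums_unique[OF p] by simp
qed

text \<open>  The image of the unit is a unit for the whole image, hence equal to \<open>1\<close> on \<open>Y\<close>.\<close>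

lemma alg_iso_unital:
  assumes iso: "alg_iso A B \<Phi>" and A: "indicator X \<in> A" "\<And>\<phi> x. \<phi> \<in> A \<Longrightarrow> x \<notin> X \<Longrightarrow> \<phi> x = 0"
    and B: "indicator Y \<in> B" "\<And>\<psi> y. \<psi> \<in> B \<Longrightarrow> y \<notin> Y \<Longrightarrow> \<psi> y = 0"
  shows "\<Phi> (indicator X) = indicator Y" "\<Phi> ` A = B"
proof -
  have hom: "alg_hom A B \<Phi>" and img: "\<Phi> ` A = B"
    using iso by (auto simp: alg_iso_def bij_betw_def)
  show "\<Phi> ` A = B" by (rule img)
  obtain \<phi> where \<phi>: "\<phi> \<in> A" "\<Phi> \<phi> = indicator Y" using B(1) img by (metis imageE)
  have "(\<lambda>x. indicator X x * \<phi> x) = \<phi>"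
    using A(2)[OF \<phi>(1)] by (auto simp: indicator_def fun_eq_iff)
  then have "\<Phi> \<phi> = (\<lambda>y. \<Phi> (indicator X) y * \<Phi> \<phi> y)"
    using hom A(1) \<phi>(1) unfolding alg_hom_def by metis
  moreover have "\<Phi> (indicator X) y = 0" if "y \<notin> Y" for y
    using B(2)[OF _ that] A(1) img by blast
  ultimately have "indicator Y y = \<Phi> (indicator X) y" for y
    unfolding \<phi>(2) by (cases "y \<in> Y") (auto simp: indicator_def fun_eq_iff split: if_splits)
  then show "\<Phi> (indicator X) = indicator Y" by auto
qed

theorem proposition9p3:
  fixes H :: "((nat \<Rightarrow> complex) \<Rightarrow> complex) set"
    and ip :: "((nat \<Rightarrow> complex) \<Rightarrow> complex) \<Rightarrow> ((nat \<Rightarrow> complex) \<Rightarrow> complex) \<Rightarrow> complex"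
    and b bt :: "nat \<Rightarrow> complex"
    and a :: "nat \<Rightarrow> real"
    and V Vt :: "(nat \<Rightarrow> complex) set"
  assumes "drury_arveson H ip"
    and "coeff_vec b \<in> l2" and "b 1 \<noteq> 0" and "l2_norm (coeff_vec b) < 1"
    and "fps_conv_radius (sq_fps b) = 1"
    and "V = disc_map b ` cball 0 1"
    and "Abs_fps a = inverse (1 - sq_fps b)"
    and "bdd_above ((\<lambda>n. \<Sum>k=0..n. a k * a (n - k) / a n) ` {1..})"
    and "automorphism_invariant H ip (disc_map b)"
    and "coeff_vec bt \<in> l2" and "l2_norm (coeff_vec bt) = 1" and "bt 1 \<noteq> 0"
    and "Vt = disc_map bt ` ball 0 1"
  shows "\<not> (\<exists>\<Phi>. alg_hom (mult_alg H ip V) (mult_alg H ip Vt) \<Phi> \<and>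
               \<Phi> (indicator V) = indicator Vt \<and>
               \<Phi> ` mult_alg H ip V = mult_alg H ip Vt)
       \<and> \<not> (\<exists>\<Phi>. alg_iso (mult_alg H ip V) (mult_alg H ip Vt) \<Phi>)"
proof -
  interpret A: embedded_disc H ip b a "cball 0 1"
  proof
    fix z :: complex assume z: "z \<in> cball 0 1"
    then have "cmod z * l2_norm (coeff_vec b) < 1"
      using assms(4) mult_left_le_one_le[of "l2_norm (coeff_vec b)" "cmod z"]
        mult_nonneg_nonpos[of "cmod z" "l2_norm (coeff_vec b)"]
      by (cases "0 \<le> l2_norm (coeff_vec b)") simp_all
    then show "disc_map b z \<in> l2_ball"
      using disc_map_in_l2[OF assms(2), of z] z by (simp add: l2_ball_def)
  next
    show "\<exists>z\<in>cball 0 1. z \<noteq> (0 :: complex)" by (intro bexI[of _ 1]) auto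
  qed (use assms in auto)
  define a' where "a' = fps_nth (inverse (1 - sq_fps bt))"
  interpret T: embedded_disc H ip bt a' "ball 0 1"
  proof
    fix z :: complex assume z: "z \<in> ball 0 1"
    then show "disc_map bt z \<in> l2_ball"
      using disc_map_in_l2[OF assms(10), of z] assms(11) by (simp add: l2_ball_def)
  next
    show "\<exists>z\<in>ball 0 1. z \<noteq> (0 :: complex)" by (intro bexI[of _ "1 / 2"]) auto
  qed (use assms in \<open>auto simp: a'_def fps_nth_inverse\<close>)
  obtain C0 where C0: "\<And>n. 1 \<le> n \<Longrightarrow> (\<Sum>k=0..n. a k * a (n - k) / a n) \<le> C0"
    using assms(8) unfolding bdd_above_def by auto
  interpret A: embedded_disc_algebra H ip b a "cball 0 1" "max 1 C0"
  proof
    fix n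
    show "(\<Sum>k\<le>n. a k * a (n - k)) \<le> max 1 C0 * a n"
    proof (cases "n = 0")
      case False
      have "(\<Sum>k\<le>n. a k * a (n - k)) / a n \<le> max 1 C0"
        using C0[of n] False by (simp add: sum_divide_distrib atLeast0AtMost)
      then show ?thesis using A.a_pos[of n] by (simp add: divide_le_eq)
    qed (simp add: A.a_0)
  qed
  have no_hom: False
    if hom: "alg_hom (mult_alg H ip V) (mult_alg H ip Vt) \<Phi>" and one: "\<Phi> (indicator V) = indicator Vt"
      and onto: "\<Phi> ` mult_alg H ip V = mult_alg H ip Vt" for \<Phi>
  proof -
    define r :: "nat \<Rightarrow> real" where "r k = 1 - 1 / (real k + 2)" for k
    define v where "v k = (\<Sum>n. fps_nth (sq_fps bt) n * r k ^ n)" for k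
    note v = sq_fps_radial_limit[OF assms(10,11), folded r_def, folded v_def]
    define z where "z k = complex_of_real (r k)" for k
    have "\<bar>r k\<bar> < 1" for k by (simp add: r_def abs_if divide_less_eq)
    then have z: "z k \<in> ball 0 1" "cmod (z k) < 1" for k
      by (simp_all only: z_def norm_of_real mem_ball_0)
    have sz: "eval_fps T.s (z k) = of_real (v k)" for k
      using sums_unique[OF sums_of_real[OF v(4)[of k], where 'a = complex]]
      by (simp add: eval_fps_def T.s_def z_def)
    have p: "(\<Sum>n\<le>N. fps_nth (sq_fps bt) n) \<le> 1" for N
      using sum_le_suminf[OF sums_summable[OF l2_sq_fps_sums[OF assms(10)]], of "{..N}"]
        sums_unique[OF l2_sq_fps_sums[OF assms(10)]] assms(11) sq_fps_nonneg by simp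
    define \<xi> where "\<xi> k \<phi> = \<Phi> \<phi> (disc_map bt (z k))" for k \<phi>
    have "algebra_character (mult_alg H ip V) V (\<xi> k)" for k
      using hom one z unfolding algebra_character_def alg_hom_def \<xi>_def assms(13) by simp
    then obtain \<sigma> where \<sigma>: "strict_mono \<sigma>"
      "\<And>\<phi>. \<phi> \<in> mult_alg H ip V \<Longrightarrow> convergent (\<lambda>i. \<xi> (\<sigma> i) \<phi>)"
      unfolding assms(6) by (rule A.characters_subconverge[of \<xi>]) blast
    have v\<sigma>: "(\<lambda>i. v (\<sigma> i)) \<longlonglongrightarrow> 1"
      using LIMSEQ_subseq_LIMSEQ[OF v(1) \<sigma>(1)] by (simp add: o_def)
    obtain \<psi> where \<psi>: "\<psi> \<in> mult_alg H ip Vt" "\<not> convergent (\<lambda>i. \<psi> (disc_map bt (z (\<sigma> i))))"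
      using T.divergent_multiplier[of "\<lambda>i. z (\<sigma> i)" "\<lambda>i. v (\<sigma> i)", OF p z sz v\<sigma> v(2,3)]
      unfolding assms(13) by blast
    have "\<psi> \<in> \<Phi> ` mult_alg H ip V" unfolding onto by (rule \<psi>(1))
    then obtain \<phi> where \<phi>: "\<psi> = \<Phi> \<phi>" "\<phi> \<in> mult_alg H ip V" by (rule imageE)
    have "convergent (\<lambda>i. \<xi> (\<sigma> i) \<phi>)" by (rule \<sigma>(2)[OF \<phi>(2)])
    then show False using \<psi>(2) by (simp add: \<xi>_def \<phi>(1))
  qed
  have one: "indicator V \<in> mult_alg H ip V" "indicator Vt \<in> mult_alg H ip Vt"
    using A.fun_of_mult_alg[of 1] T.fun_of_mult_alg[of 1]
    unfolding A.fun_of_one T.fun_of_one assms(6,13) by (simp_all add: A.W_one T.W_one)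
  have vanish: "\<phi> x = 0" if "\<phi> \<in> mult_alg H ip X" "x \<notin> X" for \<phi> x X
    using that by (simp add: mult_alg_def multipliers_def)
  have no_iso: False if iso: "alg_iso (mult_alg H ip V) (mult_alg H ip Vt) \<Phi>" for \<Phi>
  proof (rule no_hom)
    show "alg_hom (mult_alg H ip V) (mult_alg H ip Vt) \<Phi>"
      using iso by (simp add: alg_iso_def)
    show "\<Phi> (indicator V) = indicator Vt"
      by (rule alg_iso_unital(1)[OF iso one(1) _ one(2)]) (auto intro: vanish)
    show "\<Phi> ` mult_alg H ip V = mult_alg H ip Vt"
      by (rule alg_iso_unital(2)[OF iso one(1) _ one(2)]) (auto intro: vanish)
  qed
  show ?thesis using no_hom no_iso by blast
qed

end
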